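(* Let $\omega$ be a non-quasianalytic weight function. Then $(\mathcal{O}_{M,\omega}(\mathbb{R}^N),\cdot)$, with pointwise multiplication, is a multiplication topological algebra; that is, $fg\in\mathcal{O}_{M,\omega}(\mathbb{R}^N)$ for all $f,g\in\mathcal{O}_{M,\omega}(\mathbb{R}^N)$, and the bilinear map $\mathcal{O}_{M,\omega}(\mathbb{R}^N)\times\mathcal{O}_{M,\omega}(\mathbb{R}^N)\to\mathcal{O}_{M,\omega}(\mathbb{R}^N)$, $(f,g)\mapsto fg$, is (jointly) continuous.
   Context: Weights. A non-quasianalytic weight function is a continuous increasing function $\omega:[0,\infty)\to[0,\infty)$ such that: ($\alpha$) there is $K\ge 1$ with $\omega(2t)\le K(1+\omega(t))$ for all $t\ge 0$; ($\beta$) $\int_1^\infty \frac{\omega(t)}{1+t^2}\,dt<\infty$; ($\gamma$) there are $a\in\mathbb{R}$, $b>0$ with $\omega(t)\ge a+b\log(1+t)$ for all $t\ge 0$; ($\delta$) $\varphi_\omega(t)=\omega(e^t)$ is convex. It is assumed (normalization) that $\omega$ vanishes on $[0,1]$. For $x\in\mathbb{R}^N$, $\omega(x):=\omega(|x|)$. The Young conjugate is $\varphi^*_\omega(s):=\sup_{t\ge 0}\{st-\varphi_\omega(t)\}$, $s\ge 0$ (the value $+\infty$ is allowed, with $\exp(-\infty)=0$). Space. For $m,n\in\mathbb{N}$ let $\mathcal{O}^m_{n,\omega}(\mathbb{R}^N)$ be the space of all (complex-valued) $f\in C^\infty(\mathbb{R}^N)$ with $r_{m,n}(f):=\sup_{\alpha\in\mathbb{N}_0^N}\sup_{x\in\mathbb{R}^N}|\partial^\alpha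 f(x)|\exp\left(-n\omega(x)-m\varphi^*_\omega\left(\frac{|\alpha|}{m}\right)\right)<\infty$, with norm $r_{m,n}$. Set $\mathcal{O}_{M,\omega}(\mathbb{R}^N):=\bigcap_{m\ge1}\bigcup_{n\ge1}\mathcal{O}^m_{n,\omega}(\mathbb{R}^N)$ with the locally convex topology of the projective limit over $m$ of the locally convex inductive limits $\mathcal{O}^m_\omega(\mathbb{R}^N):=\mathrm{ind}_{n}\,\mathcal{O}^m_{n,\omega}(\mathbb{R}^N)$. *)

theory Defs
  imports "HOL-Analysis.Analysis"
begin

section \<open>Weight functions\<close>

definition nonquasianalytic_weight :: "(real \<Rightarrow> real) \<Rightarrow> bool" where
  "nonquasianalytic_weight \<omega> \<longleftrightarrow>
     continuous_on {0..} \<omega> \<and> mono_on {0..} \<omega> \<and> (\<forall>t\<ge>0. \<omega> t \<ge> 0) \<and>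
     (\<exists>K\<ge>1. \<forall>t\<ge>0. \<omega> (2 * t) \<le> K * (1 + \<omega> t)) \<and>
     (\<integral>\<^sup>+ t\<in>{1..}. ennreal (\<omega> t / (1 + t\<^sup>2)) \<partial>lborel) < \<infinity> \<and>
     (\<exists>a b. b > 0 \<and> (\<forall>t\<ge>0. \<omega> t \<ge> a + b * ln (1 + t))) \<and>
     convex_on UNIV (\<lambda>t. \<omega> (exp t)) \<and>
     (\<forall>t\<in>{0..1}. \<omega> t = 0)"

definition young_conjugate :: "(real \<Rightarrow> real) \<Rightarrow> real \<Rightarrow> ereal" where
  "young_conjugate \<omega> s = (SUP t\<in>{0..}. ereal (s * t - \<omega> (exp t)))"

definition exp_ereal :: "ereal \<Rightarrow> ereal" where
  "exp_ereal u = (case u of ereal r \<Rightarrow> ereal (exp r) | PInfty \<Rightarrow> \<infinity> | MInfty \<Rightarrow> 0)"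


section \<open>Partial derivatives and smooth functions\<close>

definition partial :: "'N::finite \<Rightarrow> (real^'N \<Rightarrow> complex) \<Rightarrow> real^'N \<Rightarrow> complex" where
  "partial i f x = vector_derivative (\<lambda>t. f (x + t *\<^sub>R axis i 1)) (at 0)"

text \<open>
  \<open>foldr partial [i\<^sub>1, \<dots>, i\<^sub>k] f\<close> is the iterated partial derivative
  \<open>\<partial>\<^bsub>i\<^sub>1\<^esub> \<dots> \<partial>\<^bsub>i\<^sub>k\<^esub> f\<close>;
  a function is smooth if all of these exist and are continuous.
\<close>

definition smooth :: "(real^'N::finite \<Rightarrow> complex) \<Rightarrow> bool" where
  "smooth f \<longleftrightarrow> (\<forall>is. continuous_on UNIV (foldr partial is f) \<and>
     (\<forall>i x. (\<lambda>t. foldr partial is f (x + t *\<^sub>R axis i 1)) differentiable (at 0)))"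

text \<open>
  A multi-index is a function \<open>\<alpha> :: 'N \<Rightarrow> nat\<close>. As the index type carries no order, the order in which
  the coordinates are differentiated is fixed by an arbitrary enumeration of them; for smooth
  functions, the only ones to which \<open>mderiv\<close> is applied below, it is immaterial by the
  theorem of Schwarz.
\<close>

definition coords :: "'N::finite list" where
  "coords = (SOME is. distinct is \<and> set is = UNIV)"

definition mderiv :: "('N::finite \<Rightarrow> nat) \<Rightarrow> (real^'N \<Rightarrow> complex) \<Rightarrow> real^'N \<Rightarrow> complex" where
  "mderiv \<alpha> f = foldr (\<lambda>i. partial i ^^ \<alpha> i) coords f"

lemma coords: "distinct (coords :: 'N::finite list)" "set (coords :: 'N list) = UNIV"
proof -
  have "\<exists>is :: 'N list. distinct is \<and> set is = UNIV"
    using finite_distinct_list[of "UNIV :: 'N set"] by auto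
  then have "distinct (coords :: 'N list) \<and> set (coords :: 'N list) = UNIV"
    unfolding coords_def by (rule someI_ex)
  then show "distinct (coords :: 'N list)" "set (coords :: 'N list) = UNIV" by auto
qed


section \<open>Locally convex topologies on spaces of complex-valued functions\<close>

text \<open>
  The vector space operations on functions are pointwise, and a linear space of functions is
  represented by its carrier set, which is the \<open>topspace\<close> of a topology on it.
\<close>

definition fun_subspace :: "('a \<Rightarrow> complex) set \<Rightarrow> bool" where
  "fun_subspace E \<longleftrightarrow> (\<lambda>x. 0) \<in> E \<and>
     (\<forall>f\<in>E. \<forall>g\<in>E. (\<lambda>x. f x + g x) \<in> E) \<and> (\<forall>c. \<forall>f\<in>E. (\<lambda>x. c * f x) \<in> E)"

definition fun_convex :: "('a \<Rightarrow> complex) set \<Rightarrow> bool" where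
  "fun_convex V \<longleftrightarrow> (\<forall>f\<in>V. \<forall>g\<in>V. \<forall>t\<in>{0..1::real}. (\<lambda>x. (1 - t) *\<^sub>R f x + t *\<^sub>R g x) \<in> V)"

definition locally_convex_topology :: "('a \<Rightarrow> complex) topology \<Rightarrow> bool" where
  "locally_convex_topology T \<longleftrightarrow> fun_subspace (topspace T) \<and>
     continuous_map (prod_topology T T) T (\<lambda>(f, g) x. f x + g x) \<and>
     continuous_map (prod_topology euclidean T) T (\<lambda>(c, f) x. c * f x) \<and>
     (\<forall>U. openin T U \<and> (\<lambda>x. 0) \<in> U \<longrightarrow>
        (\<exists>V. openin T V \<and> (\<lambda>x. 0) \<in> V \<and> fun_convex V \<and> V \<subseteq> U))"

definition norm_topology ::
  "('a \<Rightarrow> complex) set \<Rightarrow> (('a \<Rightarrow> complex) \<Rightarrow> ereal) \<Rightarrow> ('a \<Rightarrow> complex) topology" where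
  "norm_topology E p = topology (\<lambda>U. U \<subseteq> E \<and>
     (\<forall>f\<in>U. \<exists>e>0. \<forall>g\<in>E. p (\<lambda>x. g x - f x) < ereal e \<longrightarrow> g \<in> U))"

lemma openin_norm_topology:
  "openin (norm_topology E p) U \<longleftrightarrow>
     U \<subseteq> E \<and> (\<forall>f\<in>U. \<exists>e>0. \<forall>g\<in>E. p (\<lambda>x. g x - f x) < ereal e \<longrightarrow> g \<in> U)"
proof -
  have "istopology (\<lambda>U. U \<subseteq> E \<and> (\<forall>f\<in>U. \<exists>e>0. \<forall>g\<in>E. p (\<lambda>x. g x - f x) < ereal e \<longrightarrow> g \<in> U))"
    (is "istopology ?L")
    unfolding istopology_def
  proof (intro conjI allI impI)
    fix S U assume S: "?L S" and U: "?L U"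
    show "S \<inter> U \<subseteq> E" using S by auto
    show "\<forall>f\<in>S \<inter> U. \<exists>e>0. \<forall>g\<in>E. p (\<lambda>x. g x - f x) < ereal e \<longrightarrow> g \<in> S \<inter> U"
    proof
      fix f assume "f \<in> S \<inter> U"
      then obtain d e where "d > 0" "\<forall>g\<in>E. p (\<lambda>x. g x - f x) < ereal d \<longrightarrow> g \<in> S"
        and "e > 0" "\<forall>g\<in>E. p (\<lambda>x. g x - f x) < ereal e \<longrightarrow> g \<in> U"
        using S U by blast
      then show "\<exists>e>0. \<forall>g\<in>E. p (\<lambda>x. g x - f x) < ereal e \<longrightarrow> g \<in> S \<inter> U"
        by (intro exI[of _ "min d e"]) (auto simp flip: ereal_min simp: min_def less_le_trans split: if_splits)
    qed
  next
    fix K assume K: "\<forall>S\<in>K. ?L S"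
    then show "\<Union>K \<subseteq> E" by blast
    show "\<forall>f\<in>\<Union>K. \<exists>e>0. \<forall>g\<in>E. p (\<lambda>x. g x - f x) < ereal e \<longrightarrow> g \<in> \<Union>K"
      using K by (meson UnionE UnionI)
  qed
  then show ?thesis
    by (simp add: norm_topology_def)
qed

lemma topspace_norm_topology [simp]: "topspace (norm_topology E p) = E"
  by (rule antisym, metis openin_norm_topology openin_topspace,
      rule openin_subset, unfold openin_norm_topology, auto intro: exI[of _ 1])

text \<open>
  The inductive limit topology is the finest locally convex topology on the union making all the
  inclusions continuous, i.e. the supremum of all locally convex topologies with that property.
  The union itself is listed among the generating sets so that it is the \<open>topspace\<close> without
  any hypothesis on \<open>X\<close>; this adds nothing when the union is a linear space, as then the
  indiscrete topology on it is one of the topologies \<open>T\<close>.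
\<close>

definition inductive_limit_topology ::
  "'i set \<Rightarrow> ('i \<Rightarrow> ('a \<Rightarrow> complex) topology) \<Rightarrow> ('a \<Rightarrow> complex) topology" where
  "inductive_limit_topology I X = topology_generated_by (insert (\<Union>i\<in>I. topspace (X i))
     {U. \<exists>T. locally_convex_topology T \<and> topspace T = (\<Union>i\<in>I. topspace (X i)) \<and>
          (\<forall>i\<in>I. continuous_map (X i) T (\<lambda>f. f)) \<and> openin T U})"

lemma topspace_inductive_limit_topology:
  "topspace (inductive_limit_topology I X) = (\<Union>i\<in>I. topspace (X i))"
  unfolding inductive_limit_topology_def topology_generated_by_topspace
  by (auto dest!: openin_subset)

text \<open>
  The projective limit topology is the coarsest topology on the intersection making all the
  inclusions continuous.
\<close>

definition projective_limit_topology ::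
  "'i set \<Rightarrow> ('i \<Rightarrow> ('a \<Rightarrow> complex) topology) \<Rightarrow> ('a \<Rightarrow> complex) topology" where
  "projective_limit_topology I X = topology_generated_by
     {U \<inter> (\<Inter>i\<in>I. topspace (X i)) | U i. i \<in> I \<and> openin (X i) U}"

lemma topspace_projective_limit_topology:
  assumes "I \<noteq> {}"
  shows "topspace (projective_limit_topology I X) = (\<Inter>i\<in>I. topspace (X i))"
proof -
  obtain i where "i \<in> I" using assms by auto
  then have "topspace (X i) \<inter> (\<Inter>i\<in>I. topspace (X i)) = (\<Inter>i\<in>I. topspace (X i))"
    by auto
  with \<open>i \<in> I\<close> show ?thesis
    unfolding projective_limit_topology_def topology_generated_by_topspace
    by (intro antisym) (blast, blast intro: openin_topspace)
qed


section \<open>The space of multipliers\<close>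

definition OMnorm ::
  "(real \<Rightarrow> real) \<Rightarrow> nat \<Rightarrow> nat \<Rightarrow> (real^'N::finite \<Rightarrow> complex) \<Rightarrow> ereal" where
  "OMnorm \<omega> m n f = (SUP \<alpha>. SUP x. ereal (cmod (mderiv \<alpha> f x)) *
     exp_ereal (- ereal (real n * \<omega> (norm x))
                - ereal (real m) * young_conjugate \<omega> (real (\<Sum>i\<in>UNIV. \<alpha> i) / real m)))"

definition OMstep :: "(real \<Rightarrow> real) \<Rightarrow> nat \<Rightarrow> nat \<Rightarrow> (real^'N::finite \<Rightarrow> complex) set" where
  "OMstep \<omega> m n = {f. smooth f \<and> OMnorm \<omega> m n f < \<infinity>}"

definition OMstep_topology ::
  "(real \<Rightarrow> real) \<Rightarrow> nat \<Rightarrow> nat \<Rightarrow> (real^'N::finite \<Rightarrow> complex) topology" where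
  "OMstep_topology \<omega> m n = norm_topology (OMstep \<omega> m n) (OMnorm \<omega> m n)"

definition OMind_topology ::
  "(real \<Rightarrow> real) \<Rightarrow> nat \<Rightarrow> (real^'N::finite \<Rightarrow> complex) topology" where
  "OMind_topology \<omega> m = inductive_limit_topology {1..} (OMstep_topology \<omega> m)"

definition OM :: "(real \<Rightarrow> real) \<Rightarrow> (real^'N::finite \<Rightarrow> complex) set" where
  "OM \<omega> = (\<Inter>m\<in>{1..}. \<Union>n\<in>{1..}. OMstep \<omega> m n)"

definition OM_topology :: "(real \<Rightarrow> real) \<Rightarrow> (real^'N::finite \<Rightarrow> complex) topology" where
  "OM_topology \<omega> = projective_limit_topology {1..} (OMind_topology \<omega>)"

lemma topspace_OM_topology: "topspace (OM_topology \<omega>) = OM \<omega>"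
  by (simp add: OM_topology_def OM_def OMind_topology_def OMstep_topology_def
      topspace_projective_limit_topology topspace_inductive_limit_topology)

end

theory Submission
  imports Defs
begin

text \<open>
  Let \<open>p\<^sub>n\<close> denote the norm of the \<open>n\<close>-th step. The doubling property of \<open>\<omega>\<close> and the Leibniz rule
  give \<open>L\<close> such that multiplication is a bounded bilinear map from the steps \<open>n\<close> and \<open>k\<close> of level
  \<open>m L\<close> to the step \<open>n + k\<close> of level \<open>m\<close>. A bilinear map that is bounded on the steps of countable
  inductive limits of normed spaces is jointly continuous: the functions that are finite sums
  \<open>\<Sum> u\<^sub>j\<close> with \<open>p\<^bsub>n j\<^esub> u\<^sub>j < e\<^bsub>n j\<^esub> t\<^sub>j\<close> and \<open>\<Sum> t\<^sub>j < 1\<close> form a neighbourhood of zero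
  for any positive weights \<open>e\<close>, and if the product of the unit balls of the steps \<open>n\<close> and \<open>k\<close> lies in
  \<open>c\<^bsub>n k\<^esub> V\<close> for a convex \<open>V\<close>, then weights decreasing fast enough that
  \<open>e\<^sub>n e\<^sub>k c\<^bsub>n k\<^esub> \<le> 1\<close> make all products of two such sums fall into \<open>V\<close>.
\<close>

section \<open>Inductive limits of normed spaces\<close>

lemma fun_subspace_zero: "fun_subspace E \<Longrightarrow> (\<lambda>x. 0) \<in> E"
  and fun_subspace_add: "fun_subspace E \<Longrightarrow> f \<in> E \<Longrightarrow> g \<in> E \<Longrightarrow> (\<lambda>x. f x + g x) \<in> E"
  and fun_subspace_scale: "fun_subspace E \<Longrightarrow> f \<in> E \<Longrightarrow> (\<lambda>x. c * f x) \<in> E"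
  by (auto simp: fun_subspace_def)

lemma fun_subspace_diff:
  assumes "fun_subspace E" "f \<in> E" "g \<in> E"
  shows "(\<lambda>x. f x - g x) \<in> E"
  using fun_subspace_add[OF assms(1,2) fun_subspace_scale[OF assms(1,3), of "-1"]] by simp

text \<open>The number \<open>s\<close> is the sum of the budgets \<open>t\<close> of the pieces.
  Several pieces may come from the same step, so decompositions of two functions are simply
  concatenated, without regrouping, and statements about finite sums are proved by rule
  induction.\<close>

inductive decomp ::
  "(nat \<Rightarrow> ('a \<Rightarrow> complex) set) \<Rightarrow> (nat \<Rightarrow> ('a \<Rightarrow> complex) \<Rightarrow> ereal) \<Rightarrow> (nat \<Rightarrow> real) \<Rightarrow>
    ('a \<Rightarrow> complex) \<Rightarrow> real \<Rightarrow> bool" for E r e where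
  zero: "decomp E r e (\<lambda>x. 0) 0"
| step: "decomp E r e f s \<Longrightarrow> 1 \<le> n \<Longrightarrow> u \<in> E n \<Longrightarrow> r n u < ereal (e n * t) \<Longrightarrow> 0 < t \<Longrightarrow>
    decomp E r e (\<lambda>x. f x + u x) (s + t)"

lemma decomp_nonneg: "decomp E r e f s \<Longrightarrow> 0 \<le> s"
  by (induction rule: decomp.induct) auto

lemma decomp_add:
  assumes "decomp E r e f s" "decomp E r e g t"
  shows "decomp E r e (\<lambda>x. f x + g x) (s + t)"
  using assms(2)
proof induction
  case zero
  then show ?case using assms(1) by simp
next
  case (step g t n u t')
  from decomp.step[OF step.IH step.hyps(2-)] show ?case by (simp add: add.assoc)
qed

lemma decomp_rescale:
  assumes "decomp E r e f s" "c > 0" "\<And>n. c * e n \<le> e' n"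
  shows "decomp E r e' f (s / c)"
  using assms(1)
proof induction
  case zero
  show ?case using decomp.zero by simp
next
  case (step f s n u t)
  have "e n * t \<le> e' n * (t / c)"
    using assms(2) mult_right_mono[OF assms(3)[of n], of "t / c"] step.hyps by simp
  then have "r n u < ereal (e' n * (t / c))"
    using step.hyps(4) by (meson ereal_less_eq(3) less_le_trans)
  from decomp.step[OF step.IH step.hyps(2,3) this] step.hyps assms(2) show ?case
    by (simp add: add_divide_distrib)
qed

lemma decomp_single:
  assumes "1 \<le> n" "u \<in> E n" "r n u < ereal (e n * t)" "0 < t"
  shows "decomp E r e u t"
  using decomp.step[where f = "\<lambda>x. 0" and s = 0, OF decomp.zero, where u = u] assms by simp

definition decomp_ball ::
  "(nat \<Rightarrow> ('a \<Rightarrow> complex) set) \<Rightarrow> (nat \<Rightarrow> ('a \<Rightarrow> complex) \<Rightarrow> ereal) \<Rightarrow> (nat \<Rightarrow> real) \<Rightarrow>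
    ('a \<Rightarrow> complex) set" where
  "decomp_ball E r e = {f. \<exists>s<1. decomp E r e f s}"

lemma zero_in_decomp_ball: "(\<lambda>x. 0) \<in> decomp_ball E r e"
  using decomp.zero by (auto simp: decomp_ball_def intro!: exI[of _ 0])

lemma decomp_ball_mono:
  assumes "\<And>n. e n \<le> e' n"
  shows "decomp_ball E r e \<subseteq> decomp_ball E r e'"
  using decomp_rescale[of E r e _ _ 1 e'] assms by (auto simp: decomp_ball_def)

text \<open>A factor \<open>c\<close> in the weights is traded for a factor \<open>1 / c\<close> in
  the total budget. This is how several functions share the budget 1 later on.\<close>

lemma decomp_ball_shrink:
  assumes "f \<in> decomp_ball E r (\<lambda>n. e n / c)" "c > 0"
  shows "\<exists>s<1 / c. decomp E r e f s"
proof -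
  from assms(1) obtain s where "s < 1" "decomp E r (\<lambda>n. e n / c) f s"
    by (auto simp: decomp_ball_def)
  with decomp_rescale[OF this(2) assms(2), of e] assms(2) show ?thesis
    by (intro exI[of _ "s / c"]) (auto simp: divide_strict_right_mono)
qed

section \<open>Increasing steps with homogeneous norms, and the topology whose zero neighbourhoods
  are the decomposition balls\<close>

locale normed_steps =
  fixes E :: "nat \<Rightarrow> ('a \<Rightarrow> complex) set" and r :: "nat \<Rightarrow> ('a \<Rightarrow> complex) \<Rightarrow> ereal"
  assumes subspace: "1 \<le> n \<Longrightarrow> fun_subspace (E n)"
    and mono: "1 \<le> n \<Longrightarrow> n \<le> k \<Longrightarrow> E n \<subseteq> E k"
    and finite_norm: "1 \<le> n \<Longrightarrow> f \<in> E n \<Longrightarrow> r n f < \<infinity>"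
    and norm_scale: "1 \<le> n \<Longrightarrow> f \<in> E n \<Longrightarrow> c \<noteq> 0 \<Longrightarrow>
      r n (\<lambda>x. c * f x) = ereal (cmod c) * r n f"
begin

abbreviation total :: "('a \<Rightarrow> complex) set" where
  "total \<equiv> \<Union>n\<in>{1..}. E n"

lemma total_subspace: "fun_subspace total"
  unfolding fun_subspace_def
proof (intro conjI ballI allI)
  show "(\<lambda>x. 0) \<in> total"
    using fun_subspace_zero[OF subspace[of 1]] by auto
next
  fix f g assume "f \<in> total" "g \<in> total"
  then obtain n k where nk: "1 \<le> n" "f \<in> E n" "1 \<le> k" "g \<in> E k" by auto
  then have "f \<in> E (max n k)" "g \<in> E (max n k)" "1 \<le> max n k"
    using mono[of n "max n k"] mono[of k "max n k"] by auto
  then show "(\<lambda>x. f x + g x) \<in> total"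
    using fun_subspace_add[OF subspace] by (metis UN_I atLeast_iff)
next
  fix c f assume "f \<in> total"
  then show "(\<lambda>x. c * f x) \<in> total"
    using fun_subspace_scale[OF subspace] by (metis UN_E UN_I atLeast_iff)
qed

lemma decomp_in_total: "decomp E r e f s \<Longrightarrow> f \<in> total"
proof (induction rule: decomp.induct)
  case zero
  then show ?case using fun_subspace_zero[OF total_subspace] .
next
  case (step f s n u t)
  then have "u \<in> total" by auto
  then show ?case by (rule fun_subspace_add[OF total_subspace step.IH])
qed

lemma decomp_scale:
  assumes "decomp E r e f s"
  shows "decomp E r e (\<lambda>x. c * f x) (cmod c * s)"
proof (cases "c = 0")
  case True
  then show ?thesis using decomp.zero by simp
next
  case False
  from assms show ?thesis
  proof induction
    case zero
    then show ?case using decomp.zero by simp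
  next
    case (step f s n u t)
    have "ereal (cmod c) * r n u < ereal (cmod c) * ereal (e n * t)"
      using step.hyps(4) False by (intro ereal_mult_strict_left_mono) auto
    then have "r n (\<lambda>x. c * u x) < ereal (e n * (cmod c * t))"
      using norm_scale[OF step.hyps(2,3) False] by (simp add: mult_ac)
    moreover have "(\<lambda>x. c * u x) \<in> E n"
      by (rule fun_subspace_scale[OF subspace[OF step.hyps(2)] step.hyps(3)])
    ultimately have "decomp E r e (\<lambda>x. c * f x + c * u x) (cmod c * s + cmod c * t)"
      using step.hyps False by (intro decomp.step[OF step.IH step.hyps(2)]) auto
    then show ?case by (simp add: distrib_left)
  qed
qed

lemma norm_bound:
  assumes "f \<in> total"
  shows "\<exists>n A. 1 \<le> n \<and> f \<in> E n \<and> 0 < A \<and> r n f < ereal A"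
proof -
  obtain n where n: "1 \<le> n" "f \<in> E n" using assms by auto
  show ?thesis
  proof (cases "r n f")
    case (real c)
    \<comment> \<open>\<open>max c 0 + 1\<close> exceeds the norm strictly and is positive, so that
      it can serve as a budget.\<close>
    then show ?thesis
      using n by (intro exI[of _ n] exI[of _ "max c 0 + 1"]) auto
  next
    case MInf
    then show ?thesis using n by (intro exI[of _ n] exI[of _ 1]) auto
  qed (use finite_norm[OF n] in auto)
qed

text \<open>Decomposition balls are absorbing: an element of the union is a single piece of some
  step \<open>n\<close>, with budget \<open>A / e n\<close> for a bound \<open>A\<close> of its
  norm.\<close>

lemma decomp_total:
  assumes "f \<in> total" "\<And>n. e n > 0"
  obtains s where "decomp E r e f s"
proof -
  obtain n A where n: "1 \<le> n" "f \<in> E n" "0 < A" "r n f < ereal A"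
    using norm_bound[OF assms(1)] by blast
  have "decomp E r e f (A / e n)"
    using decomp_single[of n f E r e "A / e n"] n assms(2)[of n] by simp
  then show ?thesis using that by blast
qed

lemma decomp_ball_subset_total: "decomp_ball E r e \<subseteq> total"
  using decomp_in_total by (auto simp: decomp_ball_def)

text \<open>A concrete locally convex topology on the union, with the translates of decomposition
  balls as neighbourhoods. It is one of the topologies that generate the inductive limit topology
  and so supplies explicit open sets of the latter.\<close>

definition fine_topology :: "('a \<Rightarrow> complex) topology" where
  "fine_topology = topology (\<lambda>U. U \<subseteq> total \<and>
     (\<forall>f\<in>U. \<exists>e. (\<forall>n. e n > 0) \<and> (\<forall>g\<in>decomp_ball E r e. (\<lambda>x. f x + g x) \<in> U)))"

lemma openin_fine_topology:
  "openin fine_topology U \<longleftrightarrow> U \<subseteq> total \<and>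
     (\<forall>f\<in>U. \<exists>e. (\<forall>n. e n > 0) \<and> (\<forall>g\<in>decomp_ball E r e. (\<lambda>x. f x + g x) \<in> U))"
proof -
  let ?P = "\<lambda>U f. \<exists>e. (\<forall>n. e n > 0) \<and> (\<forall>g\<in>decomp_ball E r e. (\<lambda>x. f x + g x) \<in> U)"
  have "istopology (\<lambda>U. U \<subseteq> total \<and> (\<forall>f\<in>U. ?P U f))"
    unfolding istopology_def
  proof (rule conjI; intro allI impI)
    fix S U assume SU: "S \<subseteq> total \<and> (\<forall>f\<in>S. ?P S f)" "U \<subseteq> total \<and> (\<forall>f\<in>U. ?P U f)"
    have "?P (S \<inter> U) f" if "f \<in> S \<inter> U" for f
    proof -
      from that SU obtain d e where "\<forall>n. d n > 0" "\<forall>g\<in>decomp_ball E r d. (\<lambda>x. f x + g x) \<in> S"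
        and "\<forall>n. e n > 0" "\<forall>g\<in>decomp_ball E r e. (\<lambda>x. f x + g x) \<in> U" by blast
      then show ?thesis
        using decomp_ball_mono[of "\<lambda>n. min (d n) (e n)" d E r]
          decomp_ball_mono[of "\<lambda>n. min (d n) (e n)" e E r]
        by (intro exI[of _ "\<lambda>n. min (d n) (e n)"]) auto
    qed
    then show "S \<inter> U \<subseteq> total \<and> (\<forall>f\<in>S \<inter> U. ?P (S \<inter> U) f)" using SU by blast
  next
    fix K assume "\<forall>S\<in>K. S \<subseteq> total \<and> (\<forall>f\<in>S. ?P S f)"
    then show "\<Union>K \<subseteq> total \<and> (\<forall>f\<in>\<Union>K. ?P (\<Union>K) f)" by (meson UnionE UnionI subsetI subsetD)
  qed
  then show ?thesis by (simp add: fine_topology_def)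
qed

definition fine_nhd :: "('a \<Rightarrow> complex) \<Rightarrow> (nat \<Rightarrow> real) \<Rightarrow> ('a \<Rightarrow> complex) set" where
  "fine_nhd f e = {g. (\<lambda>x. g x - f x) \<in> decomp_ball E r e}"

lemma mem_fine_nhd: "f \<in> fine_nhd f e"
  using zero_in_decomp_ball by (simp add: fine_nhd_def)

text \<open>The budget of a member is strictly below 1. The remaining margin \<open>1 - s\<close>
  leaves room for a further ball with weights shrunk by that factor.\<close>

lemma openin_fine_nhd:
  assumes "f \<in> total" "\<And>n. e n > 0"
  shows "openin fine_topology (fine_nhd f e)"
  unfolding openin_fine_topology
proof (intro conjI ballI)
  show "fine_nhd f e \<subseteq> total"
  proof
    fix g assume "g \<in> fine_nhd f e"
    then have "(\<lambda>x. g x - f x) \<in> total"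
      using decomp_ball_subset_total by (auto simp: fine_nhd_def)
    from fun_subspace_add[OF total_subspace this assms(1)] show "g \<in> total" by simp
  qed
next
  fix g assume "g \<in> fine_nhd f e"
  then obtain s where s: "s < 1" "decomp E r e (\<lambda>x. g x - f x) s"
    by (auto simp: fine_nhd_def decomp_ball_def)
  \<comment> \<open>This is \<open>e n * (1 - s)\<close>, written as a quotient to fit
    \<open>decomp_ball_shrink\<close>.\<close>
  let ?d = "\<lambda>n. e n / (1 / (1 - s))"
  have "(\<lambda>x. g x + h x) \<in> fine_nhd f e" if h: "h \<in> decomp_ball E r ?d" for h
  proof -
    obtain t where t: "decomp E r e h t" "t < 1 - s"
      using decomp_ball_shrink[OF h] s(1) by auto
    from decomp_add[OF s(2) t(1)] show ?thesis
      using t(2) by (auto simp: fine_nhd_def decomp_ball_def algebra_simps intro!: exI[of _ "s + t"])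
  qed
  moreover have "?d n > 0" for n using assms(2)[of n] s(1) by simp
  ultimately show "\<exists>d. (\<forall>n. d n > 0) \<and> (\<forall>h\<in>decomp_ball E r d. (\<lambda>x. g x + h x) \<in> fine_nhd f e)"
    by (intro exI[of _ ?d] conjI allI ballI)
qed

lemma openin_fine_iff:
  "openin fine_topology U \<longleftrightarrow> U \<subseteq> total \<and> (\<forall>f\<in>U. \<exists>e. (\<forall>n. e n > 0) \<and> fine_nhd f e \<subseteq> U)"
proof -
  have "(\<forall>g\<in>decomp_ball E r e. (\<lambda>x. f x + g x) \<in> U) \<longleftrightarrow> fine_nhd f e \<subseteq> U" for f e
  proof
    assume *: "\<forall>g\<in>decomp_ball E r e. (\<lambda>x. f x + g x) \<in> U"
    show "fine_nhd f e \<subseteq> U"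
    proof
      fix g assume "g \<in> fine_nhd f e"
      then have "(\<lambda>x. f x + (g x - f x)) \<in> U"
        using * by (auto simp: fine_nhd_def dest: bspec[of _ _ "\<lambda>x. g x - f x"])
      then show "g \<in> U" by simp
    qed
  qed (auto simp: fine_nhd_def)
  then show ?thesis by (simp add: openin_fine_topology)
qed

lemma topspace_fine_topology [simp]: "topspace fine_topology = total"
proof
  show "topspace fine_topology \<subseteq> total"
    using openin_fine_topology openin_topspace by blast
  show "total \<subseteq> topspace fine_topology"
  proof
    fix f assume "f \<in> total"
    then have "openin fine_topology (fine_nhd f (\<lambda>_. 1))" by (rule openin_fine_nhd) simp
    then show "f \<in> topspace fine_topology" using mem_fine_nhd openin_subset by blast
  qed
qed

lemma continuous_map_into_fineI:
  assumes "\<And>p. p \<in> topspace T \<Longrightarrow> h p \<in> total"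
    and "\<And>p e. p \<in> topspace T \<Longrightarrow> (\<And>n. e n > 0) \<Longrightarrow>
      \<exists>W. openin T W \<and> p \<in> W \<and> h ` W \<subseteq> fine_nhd (h p) e"
  shows "continuous_map T fine_topology h"
  unfolding topspace_fine_topology continuous_map_def
proof (intro conjI allI impI)
  show "h \<in> topspace T \<rightarrow> total" using assms(1) by auto
  fix U assume U: "openin fine_topology U"
  show "openin T {p \<in> topspace T. h p \<in> U}"
  proof (subst openin_subopen, rule ballI)
    fix p assume p: "p \<in> {p \<in> topspace T. h p \<in> U}"
    then obtain e where e: "\<forall>n. e n > 0" "fine_nhd (h p) e \<subseteq> U"
      using U openin_fine_iff by auto
    then obtain W where "openin T W" "p \<in> W" "h ` W \<subseteq> fine_nhd (h p) e"
      using assms(2)[of p e] p by auto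
    then show "\<exists>W. openin T W \<and> p \<in> W \<and> W \<subseteq> {p \<in> topspace T. h p \<in> U}"
      using e(2) openin_subset by (intro exI[of _ W]) blast
  qed
qed

lemma continuous_map_fine_add:
  "continuous_map (prod_topology fine_topology fine_topology) fine_topology (\<lambda>(f, g) x. f x + g x)"
proof (rule continuous_map_into_fineI)
  fix p e assume p: "p \<in> topspace (prod_topology fine_topology fine_topology)"
    and e: "\<And>n::nat. e n > (0::real)"
  obtain f g where fg: "p = (f, g)" "f \<in> total" "g \<in> total" using p by auto
  let ?d = "\<lambda>n. e n / 2"
  have "(\<lambda>x. f' x + g' x) \<in> fine_nhd (\<lambda>x. f x + g x) e"
    if *: "f' \<in> fine_nhd f ?d" "g' \<in> fine_nhd g ?d" for f' g'
  proof -
    obtain s where s: "decomp E r e (\<lambda>x. f' x - f x) s" "s < 1 / 2"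
      using * decomp_ball_shrink[of "\<lambda>x. f' x - f x" E r e 2] by (auto simp: fine_nhd_def simp del: less_divide_eq_numeral1)
    obtain t where t: "decomp E r e (\<lambda>x. g' x - g x) t" "t < 1 / 2"
      using * decomp_ball_shrink[of "\<lambda>x. g' x - g x" E r e 2] by (auto simp: fine_nhd_def simp del: less_divide_eq_numeral1)
    from decomp_add[OF s(1) t(1)] s(2) t(2) show ?thesis
      by (auto simp: fine_nhd_def decomp_ball_def algebra_simps intro!: exI[of _ "s + t"])
  qed
  then show "\<exists>W. openin (prod_topology fine_topology fine_topology) W \<and> p \<in> W \<and>
    (\<lambda>(f, g) x. f x + g x) ` W \<subseteq> fine_nhd ((\<lambda>(f, g) x. f x + g x) p) e"
    using fg e by (intro exI[of _ "fine_nhd f ?d \<times> fine_nhd g ?d"])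
      (auto simp: openin_prod_Times_iff mem_fine_nhd intro!: openin_fine_nhd)
next
  fix p assume "p \<in> topspace (prod_topology fine_topology fine_topology)"
  then show "(\<lambda>(f, g) x. f x + g x) p \<in> total"
    using fun_subspace_add[OF total_subspace] by (cases p) (auto simp del: UN_iff)
qed

text \<open>Write \<open>c' * f' - c * f = c' * (f' - f) + (c' - c) * f\<close>. The first summand
  is small since \<open>c'\<close> stays bounded, the second since \<open>f\<close> has a
  decomposition with some finite total \<open>M\<close>.\<close>

lemma continuous_map_fine_scale:
  "continuous_map (prod_topology euclidean fine_topology) fine_topology (\<lambda>(c, f) x. c * f x)"
proof (rule continuous_map_into_fineI)
  fix p :: "complex \<times> ('a \<Rightarrow> complex)" and e
  assume p: "p \<in> topspace (prod_topology euclidean fine_topology)"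
    and e: "\<And>n::nat. e n > (0::real)"
  obtain c f where cf: "p = (c, f)" "f \<in> total" using p by auto
  obtain M where M: "decomp E r e f M" by (rule decomp_total[of f e, OF cf(2) e])
  have M0: "M \<ge> 0" using decomp_nonneg[OF M] .
  \<comment> \<open>As \<open>d \<le> 1\<close>, the modulus of \<open>c'\<close> is at most
    \<open>cmod c + 1\<close>, so the factor \<open>k\<close> in the weights makes the first summand
    cost less than 1/2. The other bound in \<open>d\<close> makes the second cost at most 1/2, with
    \<open>M + 1\<close> avoiding a division by zero.\<close>
  define k where "k = 2 * (cmod c + 1)"
  define d where "d = min 1 (1 / (2 * (M + 1)))"
  have k0: "k > 0" by (simp add: k_def add_nonneg_pos)
  have d0: "d > 0" using M0 by (simp add: d_def)
  have "(\<lambda>x. c' * f' x) \<in> fine_nhd (\<lambda>x. c * f x) e"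
    if *: "c' \<in> ball c d" "f' \<in> fine_nhd f (\<lambda>n. e n / k)" for c' f'
  proof -
    obtain s where s: "decomp E r e (\<lambda>x. f' x - f x) s" "s < 1 / k"
      using * k0 decomp_ball_shrink[of "\<lambda>x. f' x - f x" E r e k] by (auto simp: fine_nhd_def)
    have s0: "s \<ge> 0" using decomp_nonneg[OF s(1)] .
    have cd: "cmod (c' - c) < d" using that by (simp add: dist_norm norm_minus_commute)
    have "cmod c' \<le> cmod c + 1"
      using cd norm_triangle_ineq[of c "c' - c"] by (simp add: d_def)
    then have "cmod c' * s \<le> (cmod c + 1) * s" using s0 by (rule mult_right_mono)
    also have "\<dots> < (cmod c + 1) * (1 / k)"
      using s(2) by (intro mult_strict_left_mono) (auto simp: add_nonneg_pos)
    also have "\<dots> = 1 / 2" using k0 by (simp add: k_def field_simps)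
    finally have 1: "cmod c' * s < 1 / 2" .
    have "cmod (c' - c) * M \<le> 1 / (2 * (M + 1)) * M"
      using cd M0 by (intro mult_right_mono) (auto simp: d_def)
    also have "\<dots> \<le> 1 / 2" using M0 by (simp add: field_simps)
    finally have 2: "cmod (c' - c) * M \<le> 1 / 2" .
    from decomp_add[OF decomp_scale[OF s(1), of c'] decomp_scale[OF M, of "c' - c"]] 1 2
    show ?thesis
      by (auto simp: fine_nhd_def decomp_ball_def algebra_simps
          intro!: exI[of _ "cmod c' * s + cmod (c' - c) * M"])
  qed
  then show "\<exists>W. openin (prod_topology euclidean fine_topology) W \<and> p \<in> W \<and>
    (\<lambda>(c, f) x. c * f x) ` W \<subseteq> fine_nhd ((\<lambda>(c, f) x. c * f x) p) e"
    using cf e k0 d0 by (intro exI[of _ "ball c d \<times> fine_nhd f (\<lambda>n. e n / k)"])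
      (auto simp: openin_prod_Times_iff mem_fine_nhd intro!: openin_fine_nhd)
next
  fix p :: "complex \<times> ('a \<Rightarrow> complex)"
  assume "p \<in> topspace (prod_topology euclidean fine_topology)"
  then show "(\<lambda>(c, f) x. c * f x) p \<in> total"
    using fun_subspace_scale[OF total_subspace] by (cases p) (auto simp del: UN_iff)
qed

lemma fun_convex_decomp_ball: "fun_convex (decomp_ball E r e)"
  unfolding fun_convex_def
proof (intro ballI)
  fix f g and t :: real
  assume "f \<in> decomp_ball E r e" "g \<in> decomp_ball E r e" and t: "t \<in> {0..1}"
  then obtain a b where a: "a < 1" "decomp E r e f a" and b: "b < 1" "decomp E r e g b"
    by (auto simp: decomp_ball_def)
  have "decomp E r e (\<lambda>x. of_real (1 - t) * f x + of_real t * g x)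
      (cmod (of_real (1 - t)) * a + cmod (of_real t) * b)"
    by (intro decomp_add decomp_scale a b)
  moreover have "cmod (of_real (1 - t)) * a + cmod (of_real t) * b = (1 - t) * a + t * b"
    using t by (simp only: norm_of_real) auto
  moreover have "(1 - t) * a + t * b < 1" using t a(1) b(1) by (intro convex_bound_lt) auto
  ultimately show "(\<lambda>x. (1 - t) *\<^sub>R f x + t *\<^sub>R g x) \<in> decomp_ball E r e"
    unfolding decomp_ball_def by (auto simp: scaleR_conv_of_real)
qed

lemma locally_convex_fine_topology: "locally_convex_topology fine_topology"
  unfolding locally_convex_topology_def
proof (intro conjI allI impI)
  show "fun_subspace (topspace fine_topology)" using total_subspace by simp
next
  fix U assume U: "openin fine_topology U \<and> (\<lambda>x. 0) \<in> U"
  then obtain e where "\<forall>n. e n > 0" "fine_nhd (\<lambda>x. 0) e \<subseteq> U"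
    using openin_fine_iff by blast
  moreover have "fine_nhd (\<lambda>x. 0) e = decomp_ball E r e"
    by (simp add: fine_nhd_def)
  ultimately show "\<exists>V. openin fine_topology V \<and> (\<lambda>x. 0) \<in> V \<and> fun_convex V \<and> V \<subseteq> U"
    using openin_fine_nhd[of "\<lambda>x. 0" e] fun_subspace_zero[OF total_subspace]
      zero_in_decomp_ball fun_convex_decomp_ball by metis
qed (rule continuous_map_fine_add continuous_map_fine_scale)+

text \<open>A difference of small norm within the step \<open>n\<close> is a decomposition
  consisting of one piece.\<close>

lemma continuous_map_norm_fine:
  assumes "1 \<le> n"
  shows "continuous_map (norm_topology (E n) (r n)) fine_topology (\<lambda>f. f)"
proof (rule continuous_map_into_fineI)
  fix f e assume f: "f \<in> topspace (norm_topology (E n) (r n))" and e: "\<And>n::nat. e n > (0::real)"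
  have "openin (norm_topology (E n) (r n)) {g \<in> E n. g \<in> fine_nhd f e}"
    unfolding openin_norm_topology
  proof (intro conjI ballI)
    fix g assume g': "g \<in> {g \<in> E n. g \<in> fine_nhd f e}"
    then have g: "g \<in> E n" by simp
    have "f \<in> total" using f assms by auto
    from openin_fine_nhd[of f e, OF this e] g' obtain d
      where d: "\<forall>n. d n > 0" "fine_nhd g d \<subseteq> fine_nhd f e"
      unfolding openin_fine_iff by blast
    \<comment> \<open>The single piece gets the budget 1/2; any value strictly between 0 and 1 would
      do.\<close>
    have "h \<in> fine_nhd g d" if "h \<in> E n" "r n (\<lambda>x. h x - g x) < ereal (d n / 2)" for h
      using decomp_single[of n "\<lambda>x. h x - g x" E r d "1/2"] assms that
        fun_subspace_diff[OF subspace that(1) g]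
      by (auto simp: fine_nhd_def decomp_ball_def intro!: exI[of _ "1/2"])
    then show "\<exists>c>0. \<forall>h\<in>E n. r n (\<lambda>x. h x - g x) < ereal c \<longrightarrow> h \<in> {g \<in> E n. g \<in> fine_nhd f e}"
      using d by (intro exI[of _ "d n / 2"]) auto
  qed auto
  then show "\<exists>W. openin (norm_topology (E n) (r n)) W \<and> f \<in> W \<and> (\<lambda>f. f) ` W \<subseteq> fine_nhd f e"
    using f mem_fine_nhd by (intro exI[of _ "{g \<in> E n. g \<in> fine_nhd f e}"]) auto
qed (use assms in auto)

text \<open>The fine topology is locally convex and makes the inclusions of the steps continuous, so
  its open sets are among the generators of the inductive limit topology.\<close>

lemma openin_inductive_limit_fine:
  assumes "openin fine_topology U"
  shows "openin (inductive_limit_topology {1..} (\<lambda>n. norm_topology (E n) (r n))) U"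
  unfolding inductive_limit_topology_def
  using assms locally_convex_fine_topology continuous_map_norm_fine
  by (intro topology_generated_by_Basis) (auto intro!: exI[of _ fine_topology])

end

section \<open>Continuity of maps into and out of limit topologies\<close>

lemma continuous_map_into_inductive_limit:
  assumes "\<And>p. p \<in> topspace S \<Longrightarrow> h p \<in> (\<Union>i\<in>I. topspace (X i))"
    and "\<And>T. locally_convex_topology T \<Longrightarrow> topspace T = (\<Union>i\<in>I. topspace (X i)) \<Longrightarrow>
      (\<And>i. i \<in> I \<Longrightarrow> continuous_map (X i) T (\<lambda>f. f)) \<Longrightarrow> continuous_map S T h"
  shows "continuous_map S (inductive_limit_topology I X) h"
  unfolding inductive_limit_topology_def
proof (rule continuous_on_generated_topo)
  fix U assume "U \<in> insert (\<Union>i\<in>I. topspace (X i))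
     {U. \<exists>T. locally_convex_topology T \<and> topspace T = (\<Union>i\<in>I. topspace (X i)) \<and>
          (\<forall>i\<in>I. continuous_map (X i) T (\<lambda>f. f)) \<and> openin T U}"
  then consider "U = (\<Union>i\<in>I. topspace (X i))" |
    T where "locally_convex_topology T" "topspace T = (\<Union>i\<in>I. topspace (X i))"
      "\<And>i. i \<in> I \<Longrightarrow> continuous_map (X i) T (\<lambda>f. f)" "openin T U"
    by auto
  then show "openin S (h -` U \<inter> topspace S)"
  proof cases
    case 1
    then have "h -` U \<inter> topspace S = topspace S" using assms(1) by auto
    then show ?thesis by simp
  next
    case 2
    from openin_continuous_map_preimage[OF assms(2)[OF 2(1-3)] 2(4)] show ?thesis
      by (simp add: vimage_def Int_def conj_commute)
  qed
next
  show "h ` topspace S \<subseteq> \<Union> (insert (\<Union>i\<in>I. topspace (X i))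
     {U. \<exists>T. locally_convex_topology T \<and> topspace T = (\<Union>i\<in>I. topspace (X i)) \<and>
          (\<forall>i\<in>I. continuous_map (X i) T (\<lambda>f. f)) \<and> openin T U})"
    using assms(1) by auto
qed

lemma continuous_map_into_projective_limit:
  assumes "I \<noteq> {}" "\<And>i. i \<in> I \<Longrightarrow> continuous_map S (X i) h"
  shows "continuous_map S (projective_limit_topology I X) h"
  unfolding projective_limit_topology_def
proof (rule continuous_on_generated_topo)
  have top: "h p \<in> topspace (X i)" if "p \<in> topspace S" "i \<in> I" for p i
    using assms(2)[OF that(2)] that(1) by (auto simp: continuous_map_def)
  {
    fix U assume "U \<in> {U \<inter> (\<Inter>i\<in>I. topspace (X i)) | U i. i \<in> I \<and> openin (X i) U}"
    then obtain V i where V: "U = V \<inter> (\<Inter>i\<in>I. topspace (X i))" "i \<in> I" "openin (X i) V" by auto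
    have "h -` U \<inter> topspace S = {p \<in> topspace S. h p \<in> V}"
      using top V by auto
    then show "openin S (h -` U \<inter> topspace S)"
      using openin_continuous_map_preimage[OF assms(2)[OF V(2)] V(3)] by simp
  }
  have "topspace (projective_limit_topology I X) = (\<Inter>i\<in>I. topspace (X i))"
    by (rule topspace_projective_limit_topology[OF assms(1)])
  then show "h ` topspace S \<subseteq> \<Union> {U \<inter> (\<Inter>i\<in>I. topspace (X i)) | U i. i \<in> I \<and> openin (X i) U}"
    using top unfolding projective_limit_topology_def topology_generated_by_topspace by auto
qed

lemma continuous_map_from_projective_limit:
  assumes "i \<in> I"
  shows "continuous_map (projective_limit_topology I X) (X i) (\<lambda>f. f)"
proof -
  have top: "topspace (projective_limit_topology I X) = (\<Inter>i\<in>I. topspace (X i))"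
    using assms by (intro topspace_projective_limit_topology) auto
  show ?thesis
    unfolding continuous_map_def top
  proof (intro conjI allI impI)
    show "(\<lambda>f. f) \<in> (\<Inter>i\<in>I. topspace (X i)) \<rightarrow> topspace (X i)" using assms by auto
    fix U assume "openin (X i) U"
    then have "openin (projective_limit_topology I X) (U \<inter> (\<Inter>i\<in>I. topspace (X i)))"
      unfolding projective_limit_topology_def using assms
      by (intro topology_generated_by_Basis) auto
    then show "openin (projective_limit_topology I X) {f \<in> \<Inter>i\<in>I. topspace (X i). f \<in> U}"
      by (simp add: Int_def conj_commute)
  qed
qed

section \<open>Dilates of convex sets, and images of decompositions in them\<close>

definition dilate :: "real \<Rightarrow> ('a \<Rightarrow> complex) set \<Rightarrow> ('a \<Rightarrow> complex) set" where
  "dilate s V = (\<lambda>v x. s *\<^sub>R v x) ` V"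

text \<open>With \<open>c = t / (s + t)\<close> one has
  \<open>s v + t w = (s + t) ((1 - c) v + c w)\<close>, and convexity puts the bracket into
  \<open>V\<close>. The quotient is meaningful only for \<open>s + t \<noteq> 0\<close>, hence the
  case distinction.\<close>

lemma dilate_add:
  assumes "fun_convex V" "0 \<le> s" "0 \<le> t" "f \<in> dilate s V" "g \<in> dilate t V"
  shows "(\<lambda>x. f x + g x) \<in> dilate (s + t) V"
proof -
  obtain v w where v: "v \<in> V" "f = (\<lambda>x. s *\<^sub>R v x)" and w: "w \<in> V" "g = (\<lambda>x. t *\<^sub>R w x)"
    using assms(4,5) by (auto simp: dilate_def)
  show ?thesis
  proof (cases "s + t = 0")
    case True
    then have "s = 0" "t = 0" using assms(2,3) by auto
    then show ?thesis using v w by (auto simp: dilate_def)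
  next
    case False
    define c where "c = t / (s + t)"
    have c: "c \<in> {0..1}" "(s + t) * (1 - c) = s" "(s + t) * c = t"
      using False assms(2,3) by (auto simp: c_def field_simps)
    have "(\<lambda>x. (1 - c) *\<^sub>R v x + c *\<^sub>R w x) \<in> V"
      using assms(1) v(1) w(1) c(1) by (auto simp: fun_convex_def)
    moreover have "(s + t) *\<^sub>R ((1 - c) *\<^sub>R v x + c *\<^sub>R w x) = s *\<^sub>R v x + t *\<^sub>R w x" for x
      using c(2,3) by (simp add: scaleR_add_right)
    ultimately show ?thesis
      unfolding dilate_def v(2) w(2) by (intro image_eqI) (auto simp: fun_eq_iff)
  qed
qed

lemma dilate_le_one:
  assumes "fun_convex V" "(\<lambda>x. 0) \<in> V" "0 \<le> s" "s \<le> 1" "f \<in> dilate s V"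
  shows "f \<in> V"
proof -
  obtain v where v: "v \<in> V" "f = (\<lambda>x. s *\<^sub>R v x)" using assms(5) by (auto simp: dilate_def)
  then have "(\<lambda>x. (1 - s) *\<^sub>R 0 + s *\<^sub>R v x) \<in> V"
    using assms(1)[unfolded fun_convex_def, rule_format, OF assms(2), of v s] assms(3,4) by simp
  then show ?thesis using v by simp
qed

text \<open>If an additive map sends each piece into the dilate given by \<open>c\<close> times its
  budget, \<open>dilate_add\<close> collects the images, and the budgets add up to \<open>s\<close>.
  The map \<open>h\<close> will be multiplication by a fixed function.\<close>

lemma decomp_dilate:
  assumes "decomp E r e f s" "fun_convex V" "(\<lambda>x. 0) \<in> V" "0 \<le> c"
    and "h (\<lambda>x. 0) = (\<lambda>x. 0)"
    and "\<And>f g. h (\<lambda>x. f x + g x) = (\<lambda>x. h f x + h g x)"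
    and "\<And>n u t. 1 \<le> n \<Longrightarrow> u \<in> E n \<Longrightarrow> 0 < t \<Longrightarrow> r n u < ereal (e n * t) \<Longrightarrow> h u \<in> dilate (c * t) V"
  shows "h f \<in> dilate (c * s) V"
  using assms(1)
proof induction
  case zero
  then show ?case using assms(3,5) by (force simp: dilate_def)
next
  case (step f s n u t)
  have "(\<lambda>x. h f x + h u x) \<in> dilate (c * s + c * t) V"
    using step.hyps assms(4) decomp_nonneg[OF step.hyps(1)]
    by (intro dilate_add[OF assms(2) _ _ step.IH] assms(7)[of n]) auto
  then show ?case by (simp add: assms(6) distrib_left)
qed

text \<open>\<open>decomp_dilate\<close> is applied twice: first to \<open>g\<close>, multiplied by
  a fixed piece \<open>u\<close> of \<open>f\<close>, then to \<open>f\<close>, multiplied by the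
  whole of \<open>g\<close>. Thus only products of single pieces have to be controlled.\<close>

lemma decomp_mult_dilate:
  assumes f: "decomp E r e f s" and g: "decomp E r e g t" and V: "fun_convex V" "(\<lambda>x. 0) \<in> V"
    and uv: "\<And>n k u v a b. 1 \<le> n \<Longrightarrow> 1 \<le> k \<Longrightarrow> u \<in> E n \<Longrightarrow> v \<in> E k \<Longrightarrow> 0 < a \<Longrightarrow> 0 < b \<Longrightarrow>
      r n u < ereal (e n * a) \<Longrightarrow> r k v < ereal (e k * b) \<Longrightarrow> (\<lambda>x. u x * v x) \<in> dilate (a * b) V"
  shows "(\<lambda>x. f x * g x) \<in> dilate (s * t) V"
proof -
  have "(\<lambda>x. f x * g x) \<in> dilate (t * s) V"
  proof (rule decomp_dilate[OF f V])
    fix n u a assume u: "1 \<le> n" "u \<in> E n" "0 < a" "r n u < ereal (e n * a)"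
    have "(\<lambda>x. u x * g x) \<in> dilate (a * t) V"
      by (rule decomp_dilate[OF g V]) (use u uv in \<open>auto simp: distrib_left\<close>)
    then show "(\<lambda>x. u x * g x) \<in> dilate (t * a) V" by (simp add: mult.commute)
  qed (use decomp_nonneg[OF g] in \<open>auto simp: distrib_right\<close>)
  then show ?thesis by (simp add: mult.commute)
qed

text \<open>Continuity of the inclusion at zero yields a radius \<delta> for each step whose ball
  lies in \<open>V\<close>. Homogeneity of the norm, applied to \<open>h / t\<close>, carries this
  over to the dilates.\<close>

lemma (in normed_steps) small_in_dilate:
  assumes T: "locally_convex_topology T" "topspace T = total"
      "\<And>n. 1 \<le> n \<Longrightarrow> continuous_map (norm_topology (E n) (r n)) T (\<lambda>f. f)"
    and V: "openin T V" "(\<lambda>x. 0) \<in> V"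
  obtains \<delta> where "\<And>n. \<delta> n > (0::real)"
    "\<And>n h t. 1 \<le> n \<Longrightarrow> h \<in> E n \<Longrightarrow> 0 < t \<Longrightarrow> r n h < ereal (\<delta> n * t) \<Longrightarrow> h \<in> dilate t V"
proof -
  have "\<exists>d>0. \<forall>h\<in>E n. r n h < ereal d \<longrightarrow> h \<in> V" if n: "1 \<le> n" for n
  proof -
    have "openin (norm_topology (E n) (r n)) {f \<in> E n. f \<in> V}"
      using openin_continuous_map_preimage[OF T(3)[OF n] V(1)] by simp
    then have *: "\<forall>f\<in>{f \<in> E n. f \<in> V}. \<exists>d>0. \<forall>h\<in>E n. r n (\<lambda>x. h x - f x) < ereal d \<longrightarrow>
        h \<in> {f \<in> E n. f \<in> V}"
      unfolding openin_norm_topology by (rule conjunct2)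
    have "(\<lambda>x. 0) \<in> {f \<in> E n. f \<in> V}"
      using V(2) fun_subspace_zero[OF subspace[OF n]] by simp
    from bspec[OF * this] show ?thesis by auto
  qed
  then obtain \<delta>' where \<delta>': "\<And>n. 1 \<le> n \<Longrightarrow> \<delta>' n > 0"
    "\<And>n h. 1 \<le> n \<Longrightarrow> h \<in> E n \<Longrightarrow> r n h < ereal (\<delta>' n) \<Longrightarrow> h \<in> V"
    by metis
  \<comment> \<open>The radii come only from the steps \<open>n \<ge> 1\<close>; the value 1 at zero
    keeps the sequence positive everywhere.\<close>
  define \<delta> where "\<delta> n = (if 1 \<le> n then \<delta>' n else 1)" for n
  show thesis
  proof
    show "\<delta> n > 0" for n using \<delta>'(1) by (simp add: \<delta>_def)
    fix n h t assume n: "1 \<le> n" and h: "h \<in> E n" and t: "0 < t" and small: "r n h < ereal (\<delta> n * t)"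
    define w where "w = (\<lambda>x. complex_of_real (1 / t) * h x)"
    have "r n w = ereal (1 / t) * r n h"
      using norm_scale[OF n h, of "complex_of_real (1 / t)"] t by (simp add: w_def norm_divide)
    also have "\<dots> < ereal (1 / t) * ereal (\<delta> n * t)"
      using small t by (intro ereal_mult_strict_left_mono) auto
    also have "\<dots> = ereal (\<delta>' n)" using t n by (simp add: \<delta>_def)
    finally have "r n w < ereal (\<delta>' n)" .
    moreover have "w \<in> E n" unfolding w_def by (rule fun_subspace_scale[OF subspace[OF n] h])
    ultimately have "w \<in> V" using \<delta>'(2)[OF n] by blast
    moreover have "h = (\<lambda>x. t *\<^sub>R w x)"
      using t by (simp add: w_def scaleR_conv_of_real)
    ultimately show "h \<in> dilate t V" by (auto simp: dilate_def)
  qed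
qed

lemma continuous_map_translate:
  assumes "locally_convex_topology T" "f \<in> topspace T"
  shows "continuous_map T T (\<lambda>g x. f x + g x)"
proof -
  have "continuous_map T (prod_topology T T) (\<lambda>g. (f, g))"
    using assms(2) by (intro continuous_map_pairedI) (auto simp: continuous_map_const)
  from continuous_map_compose[OF this] assms(1) show ?thesis
    unfolding locally_convex_topology_def by (force simp: o_def)
qed

text \<open>The larger index carries the smallness: for \<open>k \<le> n\<close> one has
  \<open>n + k \<le> 2 * n\<close>, so it suffices that \<open>M * e n\<close> lies below all radii
  up to index \<open>2 * n\<close> and that \<open>e k \<le> 1\<close>.\<close>

lemma balanced_weights:
  fixes \<delta> :: "nat \<Rightarrow> real" and M :: real
  assumes "\<And>n. \<delta> n > 0" "M \<ge> 1"
  shows "\<exists>e. (\<forall>n. e n > (0::real)) \<and> (\<forall>n k. M * (e n * e k) < \<delta> (n + k)) \<and>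
    (\<forall>n. \<forall>k\<le>m. M * e n < \<delta> (n + k))"
proof -
  \<comment> \<open>The range \<open>2 * n + m\<close> serves both inequalities,
    \<open>n + k\<close> with \<open>k \<le> n\<close> and with \<open>k \<le> m\<close>. The
    inserted 1 yields \<open>e n \<le> 1\<close>.\<close>
  define \<mu> where "\<mu> n = Min (insert 1 (\<delta> ` {..2 * n + m}))" for n
  \<comment> \<open>The factor 2 makes \<open>M * e n < \<mu> n\<close> strict.\<close>
  define e where "e n = \<mu> n / (2 * M)" for n
  have \<mu>: "0 < \<mu> n" "\<mu> n \<le> 1" for n using assms(1) by (auto simp: \<mu>_def)
  have \<mu>_le: "\<mu> n \<le> \<delta> j" if "j \<le> 2 * n + m" for n j
    using that unfolding \<mu>_def by (intro Min_le) auto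
  have Me: "M * e n < \<mu> n" for n using \<mu>[of n] assms(2) by (simp add: e_def)
  have e: "0 < e n" "e n \<le> 1" for n
    using \<mu>[of n] assms(2) by (auto simp: e_def field_simps)
  have main: "M * (e n * e k) < \<delta> (n + k)" if "k \<le> n" for n k
  proof -
    have "M * (e n * e k) \<le> M * e n"
      using e[of n] e[of k] assms(2) by (simp add: mult_left_le)
    also have "\<dots> < \<delta> (n + k)" using Me[of n] \<mu>_le[of "n + k" n] that by simp
    finally show ?thesis .
  qed
  show ?thesis
  proof (intro exI[of _ e] conjI allI impI)
    show "M * (e n * e k) < \<delta> (n + k)" for n k
      using main[of k n] main[of n k] by (cases "k \<le> n") (auto simp: mult.commute add.commute)
    show "M * e n < \<delta> (n + k)" if "k \<le> m" for n k
      using Me[of n] \<mu>_le[of "n + k" n] that by simp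
  qed (rule e)
qed

text \<open>Continuity is tested against each locally convex topology \<open>T\<close> on the target
  union that makes the inclusions continuous. Near \<open>(f, g)\<close>, with
  \<open>u = f' - f\<close> and \<open>v = g' - g\<close>, one has
  \<open>f' * g' - f * g = u * v + f * v + u * g\<close>, and each summand is put into a dilate of a
  convex zero neighbourhood.\<close>

lemma continuous_map_mult_inductive_limit:
  fixes E F :: "nat \<Rightarrow> ('a \<Rightarrow> complex) set"
  assumes E: "normed_steps E r" and F: "normed_steps F q" and C: "C \<ge> 1"
    and mult: "\<And>n k f g a b. 1 \<le> n \<Longrightarrow> 1 \<le> k \<Longrightarrow> f \<in> E n \<Longrightarrow> g \<in> E k \<Longrightarrow> 0 < a \<Longrightarrow> 0 < b \<Longrightarrow>
      r n f < ereal a \<Longrightarrow> r k g < ereal b \<Longrightarrow>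
      (\<lambda>x. f x * g x) \<in> F (n + k) \<and> q (n + k) (\<lambda>x. f x * g x) \<le> ereal (C * (a * b))"
  defines "XE \<equiv> inductive_limit_topology {1..} (\<lambda>n. norm_topology (E n) (r n))"
    and "XF \<equiv> inductive_limit_topology {1..} (\<lambda>n. norm_topology (F n) (q n))"
  shows "continuous_map (prod_topology XE XE) XF (\<lambda>(f, g) x. f x * g x)"
proof -
  interpret E: normed_steps E r by fact
  interpret F: normed_steps F q by fact
  have top: "topspace XE = E.total"
    by (simp add: XE_def topspace_inductive_limit_topology)
  have in_total: "(\<lambda>x. f x * g x) \<in> F.total" if f: "f \<in> E.total" and g: "g \<in> E.total" for f g
  proof -
    obtain n A where "1 \<le> n" "f \<in> E n" "0 < A" "r n f < ereal A" using E.norm_bound[OF f] by auto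
    moreover obtain k B where "1 \<le> k" "g \<in> E k" "0 < B" "r k g < ereal B" using E.norm_bound[OF g] by auto
    ultimately have "(\<lambda>x. f x * g x) \<in> F (n + k)" "1 \<le> n + k" using mult[of n k f g A B] by auto
    then show ?thesis by auto
  qed
  show ?thesis
    unfolding XF_def
  proof (rule continuous_map_into_inductive_limit)
    fix p assume "p \<in> topspace (prod_topology XE XE)"
    then show "(\<lambda>(f, g) x. f x * g x) p \<in> (\<Union>i\<in>{1..}. topspace (norm_topology (F i) (q i)))"
      using in_total by (cases p) (simp add: top del: UN_iff)
  next
    fix T assume T: "locally_convex_topology T"
      and topT: "topspace T = (\<Union>i\<in>{1..}. topspace (norm_topology (F i) (q i)))"
      and incl: "\<And>i. i \<in> {1..} \<Longrightarrow> continuous_map (norm_topology (F i) (q i)) T (\<lambda>f. f)"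
    from topT have topT: "topspace T = F.total" by simp
    have nhd: "\<exists>W. openin (prod_topology XE XE) W \<and> (f, g) \<in> W \<and>
        (\<forall>(f', g')\<in>W. (\<lambda>x. f' x * g' x) \<in> U)"
      if U: "openin T U" and f: "f \<in> E.total" and g: "g \<in> E.total" and fg: "(\<lambda>x. f x * g x) \<in> U" for U f g
    proof -
      \<comment> \<open>Translation by the product \<open>f * g\<close> turns the neighbourhood
        \<open>U\<close> of it into a neighbourhood of zero, inside which a convex \<open>V\<close>
        exists.\<close>
      define U0 where "U0 = {h \<in> topspace T. (\<lambda>x. f x * g x + h x) \<in> U}"
      have "openin T U0"
        unfolding U0_def using in_total[OF f g]
        by (intro openin_continuous_map_preimage[OF continuous_map_translate[OF T] U]) (simp add: topT del: UN_iff)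
      moreover have "(\<lambda>x. 0) \<in> U0"
        using fg fun_subspace_zero[OF F.total_subspace] by (simp add: U0_def topT del: UN_iff)
      ultimately obtain V where V: "openin T V" "(\<lambda>x. 0) \<in> V" "fun_convex V" "V \<subseteq> U0"
        using T unfolding locally_convex_topology_def by blast
      obtain \<delta> where \<delta>: "\<And>n. \<delta> n > 0"
        "\<And>n h t. 1 \<le> n \<Longrightarrow> h \<in> F n \<Longrightarrow> 0 < t \<Longrightarrow> q n h < ereal (\<delta> n * t) \<Longrightarrow> h \<in> dilate t V"
        using F.small_in_dilate[OF T topT _ V(1,2)] incl by auto
      obtain a A where a: "1 \<le> a" "f \<in> E a" "0 < A" "r a f < ereal A" using E.norm_bound[OF f] by auto
      obtain b B where b: "1 \<le> b" "g \<in> E b" "0 < B" "r b g < ereal B" using E.norm_bound[OF g] by auto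
      \<comment> \<open>This constant dominates \<open>C\<close>, \<open>C * A\<close> and
        \<open>C * B\<close>, so that one weight sequence handles the products of two pieces as well
        as those of a piece with \<open>f\<close> or \<open>g\<close>.\<close>
      define M where "M = C * (A + B + 1)"
      have M: "M \<ge> 1" "C \<le> M" "C * A \<le> M" "C * B \<le> M"
      proof -
        show "C \<le> M" "C * A \<le> M" "C * B \<le> M"
          using C a(3) b(3) unfolding M_def by (auto simp: algebra_simps)
        then show "M \<ge> 1" using C by simp
      qed
      obtain e where e: "\<And>n. e n > 0" "\<And>n k. M * (e n * e k) < \<delta> (n + k)"
        "\<And>n k. k \<le> max a b \<Longrightarrow> M * e n < \<delta> (n + k)"
        using balanced_weights[of \<delta> M "max a b", OF \<delta>(1) M(1)] by auto
      have product: "(\<lambda>x. u x * v x) \<in> dilate t V"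
        if "1 \<le> n" "1 \<le> k" "u \<in> E n" "v \<in> E k" "0 < c" "0 < d" "r n u < ereal c" "r k v < ereal d"
          "0 < t" "C * (c * d) < \<delta> (n + k) * t" for n k u v c d t
        using mult[OF that(1-8)] that(1,9,10)
        by (intro \<delta>(2)[of "n + k"]) (auto elim: le_less_trans)
      have *: "(\<lambda>x. u x * v x) \<in> dilate (s * t) V"
        if u: "decomp E r e u s" and v: "decomp E r e v t" for u v s t
      proof (rule decomp_mult_dilate[OF u v V(3,2)])
        fix n k :: nat and u v :: "'a \<Rightarrow> complex" and c d :: real
        assume n: "1 \<le> n" "1 \<le> k" "u \<in> E n" "v \<in> E k" "0 < c" "0 < d"
          "r n u < ereal (e n * c)" "r k v < ereal (e k * d)"
        have "C * (e n * e k) < \<delta> (n + k)"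
          using M(2) e(1)[of n] e(1)[of k] e(2)[of n k]
          by (meson le_less_trans mult_right_mono mult_nonneg_nonneg less_imp_le)
        then have "C * (e n * e k) * (c * d) < \<delta> (n + k) * (c * d)"
          using n by (intro mult_strict_right_mono) auto
        then show "(\<lambda>x. u x * v x) \<in> dilate (c * d) V"
          using n e(1) by (intro product[of n k u v "e n * c" "e k * d"]) (auto simp: mult_ac)
      qed
      \<comment> \<open>The fixed factor \<open>f\<close> lies in step \<open>a\<close> with norm
        below \<open>A\<close>, so a piece from step \<open>k\<close> has its product in step
        \<open>a + k\<close>. This is what the third property of \<open>e\<close>, with
        \<open>k\<close> at most \<open>max a b\<close>, is for.\<close>
      have left: "(\<lambda>x. f x * v x) \<in> dilate (1 * t) V" if v: "decomp E r e v t" for v t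
      proof (rule decomp_dilate[OF v V(3,2)])
        fix k :: nat and v :: "'a \<Rightarrow> complex" and d :: real
        assume k: "1 \<le> k" "v \<in> E k" "0 < d" "r k v < ereal (e k * d)"
        have "C * A * e k < \<delta> (a + k)"
          using M(3) e(1)[of k] e(3)[of a k]
          by (metis add.commute le_less_trans less_imp_le max.cobounded1 mult_right_mono)
        then have "C * A * e k * d < \<delta> (a + k) * d"
          using k by (intro mult_strict_right_mono)
        then show "(\<lambda>x. f x * v x) \<in> dilate (1 * d) V"
          using k a e(1) by (intro product[of a k f v A "e k * d"]) (auto simp: mult_ac)
      qed (auto simp: distrib_left)
      have right: "(\<lambda>x. u x * g x) \<in> dilate (1 * s) V" if u: "decomp E r e u s" for u s
      proof (rule decomp_dilate[OF u V(3,2)])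
        fix n :: nat and u :: "'a \<Rightarrow> complex" and c :: real
        assume n: "1 \<le> n" "u \<in> E n" "0 < c" "r n u < ereal (e n * c)"
        have "C * B * e n < \<delta> (n + b)"
          using M(4) e(1)[of n] e(3)[of b n]
          by (metis le_less_trans less_imp_le max.cobounded2 mult_right_mono)
        then have "C * B * e n * c < \<delta> (n + b) * c"
          using n by (intro mult_strict_right_mono)
        then show "(\<lambda>x. u x * g x) \<in> dilate (1 * c) V"
          using n b e(1) by (intro product[of n b u g "e n * c" B]) (auto simp: mult_ac)
      qed (auto simp: distrib_right)
      \<comment> \<open>Thirds give \<open>s, t < 1 / 3\<close>, so the three summands together need
        \<open>s * t + t + s \<le> 1\<close>.\<close>
      define W where "W = E.fine_nhd f (\<lambda>n. e n / 3) \<times> E.fine_nhd g (\<lambda>n. e n / 3)"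
      have "openin (prod_topology XE XE) W"
        unfolding W_def XE_def openin_prod_Times_iff
        using e(1) f g
        by (intro disjI2 conjI E.openin_inductive_limit_fine E.openin_fine_nhd) auto
      moreover have "(f, g) \<in> W" by (simp add: W_def E.mem_fine_nhd)
      moreover have "(\<lambda>x. f' x * g' x) \<in> U" if "(f', g') \<in> W" for f' g'
      proof -
        define u where "u = (\<lambda>x. f' x - f x)"
        define v where "v = (\<lambda>x. g' x - g x)"
        have "u \<in> decomp_ball E r (\<lambda>n. e n / 3)" "v \<in> decomp_ball E r (\<lambda>n. e n / 3)"
          using that by (auto simp: W_def u_def v_def E.fine_nhd_def)
        then obtain s t where s: "s < 1 / 3" "decomp E r e u s" and t: "t < 1 / 3" "decomp E r e v t"
          using decomp_ball_shrink[of u E r e 3] decomp_ball_shrink[of v E r e 3] by auto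
        have st: "0 \<le> s" "0 \<le> t" using decomp_nonneg s t by auto
        have "s * t \<le> 1 / 3 * 1" using st s(1) t(1) by (intro mult_mono) auto
        then have le: "s * t + (1 * t + 1 * s) \<le> 1" using s(1) t(1) by simp
        have "(\<lambda>x. u x * v x + (f x * v x + u x * g x)) \<in> dilate (s * t + (1 * t + 1 * s)) V"
          using st by (intro dilate_add[OF V(3)] * left right s t) auto
        then have "(\<lambda>x. u x * v x + (f x * v x + u x * g x)) \<in> V"
          using dilate_le_one[OF V(3,2) _ le] st by simp
        then have "(\<lambda>x. f x * g x + (u x * v x + (f x * v x + u x * g x))) \<in> U"
          using V(4) by (auto simp: U0_def)
        then show ?thesis by (simp add: u_def v_def algebra_simps)
      qed
      ultimately show ?thesis by blast
    qed
    show "continuous_map (prod_topology XE XE) T (\<lambda>(f, g) x. f x * g x)"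
      unfolding continuous_map_def
    proof (intro conjI allI impI)
      show "(\<lambda>(f, g) x. f x * g x) \<in> topspace (prod_topology XE XE) \<rightarrow> topspace T"
        using in_total by (auto simp: top topT simp del: UN_iff)
      fix U assume U: "openin T U"
      show "openin (prod_topology XE XE)
          {p \<in> topspace (prod_topology XE XE). (\<lambda>(f, g) x. f x * g x) p \<in> U}"
      proof (subst openin_subopen, rule ballI)
        fix p assume p: "p \<in> {p \<in> topspace (prod_topology XE XE). (\<lambda>(f, g) x. f x * g x) p \<in> U}"
        obtain f g where fg: "p = (f, g)" by (cases p)
        then obtain W where W: "openin (prod_topology XE XE) W" "(f, g) \<in> W"
          "\<forall>(f', g')\<in>W. (\<lambda>x. f' x * g' x) \<in> U"
          using nhd[OF U, of f g] p by (auto simp: top simp del: UN_iff)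
        then show "\<exists>W. openin (prod_topology XE XE) W \<and> p \<in> W \<and>
            W \<subseteq> {p \<in> topspace (prod_topology XE XE). (\<lambda>(f, g) x. f x * g x) p \<in> U}"
          using fg openin_subset[OF W(1)] by (intro exI[of _ W]) auto
      qed
    qed
  qed
qed

section \<open>Smooth functions and the Leibniz rule\<close>

lemma smooth_has_partial:
  assumes "smooth f"
  shows "((\<lambda>t. foldr partial is f (x + t *\<^sub>R axis i 1)) has_vector_derivative
    foldr partial (i # is) f x) (at 0)"
proof -
  have "(\<lambda>t. foldr partial is f (x + t *\<^sub>R axis i 1)) differentiable (at 0)"
    using assms unfolding smooth_def by blast
  then show ?thesis by (simp add: vector_derivative_works partial_def)
qed

text \<open>A family of candidates, indexed by lists and closed under taking one more partial
  derivative, must be the family of iterated partial derivatives, by induction on the list.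
  Smoothness and the formula are thus obtained together.\<close>

lemma smoothI:
  assumes "\<And>x. D [] x = f x" "\<And>is. continuous_on UNIV (D is)"
    and "\<And>is i x. ((\<lambda>t. D is (x + t *\<^sub>R axis i 1)) has_vector_derivative D (i # is) x) (at 0)"
  shows "smooth f" "foldr partial is f = D is"
proof -
  have *: "foldr partial is f = D is" for "is"
  proof (induction "is")
    case Nil
    show ?case using assms(1) by auto
  next
    case (Cons i "is")
    then show ?case using vector_derivative_at[OF assms(3)] by (auto simp: partial_def)
  qed
  then show "foldr partial is f = D is" .
  show "smooth f"
    unfolding smooth_def * using assms(2) differentiableI_vector[OF assms(3)] by blast
qed

lemma smooth_continuous: "smooth f \<Longrightarrow> continuous_on UNIV (foldr partial is f)"
  by (simp add: smooth_def)

lemma smooth_zero: "smooth (\<lambda>x. 0)" "foldr partial is (\<lambda>x. 0) = (\<lambda>x. 0)"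
  by (rule smoothI[of "\<lambda>_ _. 0"]; simp)+

lemma
  assumes "smooth f" "smooth g"
  shows smooth_add: "smooth (\<lambda>x. f x + g x)"
    and foldr_partial_add:
      "foldr partial is (\<lambda>x. f x + g x) = (\<lambda>x. foldr partial is f x + foldr partial is g x)"
proof -
  let ?D = "\<lambda>is x. foldr partial is f x + foldr partial is g x"
  have "((\<lambda>t. ?D is (x + t *\<^sub>R axis i 1)) has_vector_derivative ?D (i # is) x) (at 0)" for "is" i x
    by (intro has_vector_derivative_add smooth_has_partial assms)
  moreover have "continuous_on UNIV (?D is)" for "is"
    by (intro continuous_on_add smooth_continuous assms)
  ultimately show "smooth (\<lambda>x. f x + g x)" "foldr partial is (\<lambda>x. f x + g x) = ?D is"
    using smoothI[of ?D] by simp_all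
qed

lemma
  assumes "smooth f"
  shows smooth_scale: "smooth (\<lambda>x. c * f x)"
    and foldr_partial_scale: "foldr partial is (\<lambda>x. c * f x) = (\<lambda>x. c * foldr partial is f x)"
proof -
  let ?D = "\<lambda>is x. c * foldr partial is f x"
  have "((\<lambda>t. ?D is (x + t *\<^sub>R axis i 1)) has_vector_derivative ?D (i # is) x) (at 0)" for "is" i x
    by (intro has_vector_derivative_mult_right smooth_has_partial assms)
  moreover have "continuous_on UNIV (?D is)" for "is"
    by (intro continuous_on_mult_left smooth_continuous assms)
  ultimately show "smooth (\<lambda>x. c * f x)" "foldr partial is (\<lambda>x. c * f x) = ?D is"
    using smoothI[of ?D] by simp_all
qed

text \<open>Each entry goes to one of two sublists, and the order is kept. Equal pairs are listed
  repeatedly, and this multiplicity takes the place of binomial coefficients in the Leibniz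
  formula.\<close>

primrec list_splits :: "'a list \<Rightarrow> ('a list \<times> 'a list) list" where
  "list_splits [] = [([], [])]"
| "list_splits (i # is) =
    map (apfst (Cons i)) (list_splits is) @ map (apsnd (Cons i)) (list_splits is)"

lemma length_list_splits: "length (list_splits is) = 2 ^ length is"
  by (induction "is") auto

lemma has_vector_derivative_sum_list:
  assumes "\<And>p. p \<in> set ps \<Longrightarrow> (F p has_vector_derivative F' p) net"
  shows "((\<lambda>t. \<Sum>p\<leftarrow>ps. F p t) has_vector_derivative (\<Sum>p\<leftarrow>ps. F' p)) net"
  using assms by (induction ps) (auto intro!: has_vector_derivative_add)

lemma continuous_on_sum_list:
  fixes F :: "'p \<Rightarrow> 'a::topological_space \<Rightarrow> 'b::real_normed_vector"
  assumes "\<And>p. p \<in> set ps \<Longrightarrow> continuous_on S (F p)"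
  shows "continuous_on S (\<lambda>x. \<Sum>p\<leftarrow>ps. F p x)"
  using assms by (induction ps) (auto intro!: continuous_on_add)

text \<open>The product rule in direction \<open>i\<close> turns the term of a split
  \<open>(A, B)\<close> into those of \<open>(i # A, B)\<close> and \<open>(A, i # B)\<close>, which
  is the recursion of \<open>list_splits\<close>.\<close>

lemma
  fixes f g :: "real^'N::finite \<Rightarrow> complex"
  assumes "smooth f" "smooth g"
  shows smooth_mult: "smooth (\<lambda>x. f x * g x)"
    and foldr_partial_mult: "foldr partial is (\<lambda>x. f x * g x) =
      (\<lambda>x. \<Sum>(A, B)\<leftarrow>list_splits is. foldr partial A f x * foldr partial B g x)"
proof -
  let ?D = "\<lambda>is x. \<Sum>(A, B)\<leftarrow>list_splits is. foldr partial A f x * foldr partial B g x"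
  have D: "((\<lambda>t. ?D is (x + t *\<^sub>R axis i 1)) has_vector_derivative ?D (i # is) x) (at 0)" for "is" i x
  proof -
    let ?F' = "\<lambda>(A, B). foldr partial A f x * foldr partial (i # B) g x +
      foldr partial (i # A) f x * foldr partial B g x"
    have "((\<lambda>t. ?D is (x + t *\<^sub>R axis i 1)) has_vector_derivative
        (\<Sum>p\<leftarrow>list_splits is. ?F' p)) (at 0)"
    proof (rule has_vector_derivative_sum_list, clarify)
      fix A B :: "'N list"
      from has_vector_derivative_mult[OF smooth_has_partial[OF assms(1)] smooth_has_partial[OF assms(2)],
          of A x i B x i]
      show "((\<lambda>t. foldr partial A f (x + t *\<^sub>R axis i 1) * foldr partial B g (x + t *\<^sub>R axis i 1))
        has_vector_derivative foldr partial A f x * foldr partial (i # B) g x +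
          foldr partial (i # A) f x * foldr partial B g x) (at 0)"
        by simp
    qed
    also have "(\<Sum>p\<leftarrow>list_splits is. ?F' p) = ?D (i # is) x"
      by (simp add: comp_def case_prod_unfold sum_list_addf)
    finally show ?thesis .
  qed
  have cont: "continuous_on UNIV (?D is)" for "is"
    by (rule continuous_on_sum_list)
      (auto simp: case_prod_unfold intro!: continuous_on_mult smooth_continuous assms)
  show "smooth (\<lambda>x. f x * g x)" "foldr partial is (\<lambda>x. f x * g x) = ?D is"
    by (rule smoothI[of ?D]; (rule D cont | simp))+
qed

section \<open>Multi-index derivatives of products\<close>

definition mlist :: "'N list \<Rightarrow> ('N \<Rightarrow> nat) \<Rightarrow> 'N list" where
  "mlist cs \<alpha> = concat (map (\<lambda>i. replicate (\<alpha> i) i) cs)"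

text \<open>A block of \<alpha>(i) equal entries is the power
  \<open>partial i ^^ \<alpha> i\<close>. Multi-index derivatives thereby become accessible to the
  Leibniz formula for lists.\<close>

lemma mderiv_eq_foldr: "mderiv \<alpha> f = foldr partial (mlist coords \<alpha>) f"
proof -
  have "foldr (\<lambda>i. partial i ^^ \<alpha> i) cs f = foldr partial (mlist cs \<alpha>) f" for cs :: "'a list"
    by (induction cs) (simp_all add: mlist_def foldr_replicate)
  then show ?thesis by (simp add: mderiv_def)
qed

lemma length_mlist: "distinct cs \<Longrightarrow> length (mlist cs \<alpha>) = sum \<alpha> (set cs)"
  by (simp add: mlist_def length_concat comp_def sum_list_distinct_conv_sum_set)

lemma length_mlist_coords: "length (mlist coords \<alpha>) = (\<Sum>i\<in>UNIV. \<alpha> i)"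
  by (simp add: length_mlist coords)

lemma list_splits_append:
  "(A, B) \<in> set (list_splits (xs @ ys)) \<Longrightarrow>
    \<exists>A1 A2 B1 B2. A = A1 @ A2 \<and> B = B1 @ B2 \<and>
      (A1, B1) \<in> set (list_splits xs) \<and> (A2, B2) \<in> set (list_splits ys)"
proof (induction xs arbitrary: A B)
  case (Cons x xs)
  from Cons.prems consider A' where "A = x # A'" "(A', B) \<in> set (list_splits (xs @ ys))" |
    B' where "B = x # B'" "(A, B') \<in> set (list_splits (xs @ ys))"
    by auto
  then show ?case
  proof cases
    case 1
    from Cons.IH[OF 1(2)] obtain A1 A2 B1 B2 where "A' = A1 @ A2" "B = B1 @ B2"
      "(A1, B1) \<in> set (list_splits xs)" "(A2, B2) \<in> set (list_splits ys)" by blast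
    then show ?thesis using 1
      by (intro exI[of _ "x # A1"] exI[of _ A2] exI[of _ B1] exI[of _ B2]) (auto intro: rev_image_eqI)
  next
    case 2
    from Cons.IH[OF 2(2)] obtain A1 A2 B1 B2 where "A = A1 @ A2" "B' = B1 @ B2"
      "(A1, B1) \<in> set (list_splits xs)" "(A2, B2) \<in> set (list_splits ys)" by blast
    then show ?thesis using 2
      by (intro exI[of _ A1] exI[of _ A2] exI[of _ "x # B1"] exI[of _ B2]) (auto intro: rev_image_eqI)
  qed
qed auto

lemma list_splits_replicate:
  "(A, B) \<in> set (list_splits (replicate n i)) \<Longrightarrow> \<exists>a b. A = replicate a i \<and> B = replicate b i"
proof (induction n arbitrary: A B)
  case (Suc n)
  then obtain A' B' where *: "(A', B') \<in> set (list_splits (replicate n i))"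
    "A = i # A' \<and> B = B' \<or> A = A' \<and> B = i # B'" by auto
  from Suc.IH[OF *(1)] *(2) show ?case by (metis replicate_Suc)
qed auto

lemma length_list_splits_member:
  "(A, B) \<in> set (list_splits is) \<Longrightarrow> length A + length B = length is"
  by (induction "is" arbitrary: A B) auto

text \<open>The two halves of a split of a sorted list are sorted, so no derivatives have to be commuted
  to recognize them as multi-index derivatives.\<close>

lemma list_splits_mlist:
  assumes "(A, B) \<in> set (list_splits (mlist cs \<alpha>))" "distinct cs"
  shows "\<exists>\<beta> \<gamma>. A = mlist cs \<beta> \<and> B = mlist cs \<gamma>"
  using assms
proof (induction cs arbitrary: A B)
  case Nil
  then show ?case by (simp add: mlist_def)
next
  case (Cons i cs)
  have "(A, B) \<in> set (list_splits (replicate (\<alpha> i) i @ mlist cs \<alpha>))"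
    using Cons.prems(1) by (simp add: mlist_def)
  from list_splits_append[OF this] obtain A1 A2 B1 B2 where
    split: "A = A1 @ A2" "B = B1 @ B2" "(A1, B1) \<in> set (list_splits (replicate (\<alpha> i) i))"
      "(A2, B2) \<in> set (list_splits (mlist cs \<alpha>))" by blast
  obtain a b where ab: "A1 = replicate a i" "B1 = replicate b i"
    using list_splits_replicate[OF split(3)] by blast
  obtain \<beta> \<gamma> where \<beta>\<gamma>: "A2 = mlist cs \<beta>" "B2 = mlist cs \<gamma>"
    using Cons.IH[OF split(4)] Cons.prems(2) by auto
  have upd: "mlist (i # cs) (\<delta>(i := d)) = replicate d i @ mlist cs \<delta>" for \<delta> d
  proof -
    have "mlist cs (\<delta>(i := d)) = mlist cs \<delta>"
      unfolding mlist_def using Cons.prems(2) by (intro arg_cong[where f = concat] map_cong) auto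
    then show ?thesis by (simp add: mlist_def)
  qed
  have "A = mlist (i # cs) (\<beta>(i := a))" "B = mlist (i # cs) (\<gamma>(i := b))"
    unfolding upd using split ab \<beta>\<gamma> by simp_all
  then show ?case by blast
qed

text \<open>The Leibniz sum has 2 to the power |\<alpha>| terms. Both factors of each term are
  multi-index derivatives with orders adding up to |\<alpha>|, so every term is at most
  \<open>c\<close>.\<close>

lemma mderiv_mult_bound:
  fixes f g :: "real^'N::finite \<Rightarrow> complex"
  assumes "smooth f" "smooth g"
    and "\<And>\<beta> \<gamma>. (\<Sum>i\<in>UNIV. \<beta> i) + (\<Sum>i\<in>UNIV. \<gamma> i) = (\<Sum>i\<in>UNIV. \<alpha> i) \<Longrightarrow>
      cmod (mderiv \<beta> f x) * cmod (mderiv \<gamma> g x) \<le> c"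
  shows "cmod (mderiv \<alpha> (\<lambda>x. f x * g x) x) \<le> 2 ^ (\<Sum>i\<in>UNIV. \<alpha> i) * c"
proof -
  let ?L = "list_splits (mlist coords \<alpha>)"
  have *: "cmod (foldr partial A f x * foldr partial B g x) \<le> c" if AB: "(A, B) \<in> set ?L" for A B
  proof -
    obtain \<beta> \<gamma> where "A = mlist coords \<beta>" "B = mlist coords \<gamma>"
      using list_splits_mlist[OF AB coords(1)] by blast
    moreover from this have "(\<Sum>i\<in>UNIV. \<beta> i) + (\<Sum>i\<in>UNIV. \<gamma> i) = (\<Sum>i\<in>UNIV. \<alpha> i)"
      using length_list_splits_member[OF AB] by (simp add: length_mlist_coords)
    ultimately show ?thesis using assms(3) by (simp add: mderiv_eq_foldr norm_mult)
  qed
  \<comment> \<open>Stated for every list of terms taken from the splits, so that induction on the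
    list applies.\<close>
  have "cmod (\<Sum>(A, B)\<leftarrow>ps. foldr partial A f x * foldr partial B g x) \<le> real (length ps) * c"
    if "set ps \<subseteq> set ?L" for ps
    using that
  proof (induction ps)
    case (Cons p ps)
    obtain A B where p: "p = (A, B)" by (cases p)
    have "cmod (foldr partial A f x * foldr partial B g x) \<le> c" using Cons.prems p by (intro *) auto
    moreover have "cmod (\<Sum>(A, B)\<leftarrow>ps. foldr partial A f x * foldr partial B g x) \<le> real (length ps) * c"
      using Cons by simp
    ultimately show ?case
      unfolding p by (simp add: distrib_right norm_triangle_le)
  qed simp
  from this[of ?L] show ?thesis
    by (simp add: mderiv_eq_foldr foldr_partial_mult[OF assms(1,2)] length_list_splits length_mlist_coords)
qed

section \<open>Young conjugates and the norms\<close>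

lemma young_conjugate_le_iff:
  "young_conjugate \<omega> s \<le> ereal c \<longleftrightarrow> (\<forall>t\<ge>0. s * t - \<omega> (exp t) \<le> c)"
  by (auto simp: young_conjugate_def SUP_le_iff)

lemma young_conjugate_nonneg:
  assumes "nonquasianalytic_weight \<omega>"
  shows "0 \<le> young_conjugate \<omega> s"
proof -
  have "ereal (s * 0 - \<omega> (exp 0)) \<le> young_conjugate \<omega> s"
    unfolding young_conjugate_def by (rule SUP_upper) simp
  then show ?thesis using assms by (simp add: nonquasianalytic_weight_def zero_ereal_def)
qed

lemma weight_nonneg: "nonquasianalytic_weight \<omega> \<Longrightarrow> 0 \<le> t \<Longrightarrow> 0 \<le> \<omega> t"
  by (simp add: nonquasianalytic_weight_def)

text \<open>For \<open>0 \<le> k \<le> 1\<close> the conjugate at \<open>k * (a + b)\<close> is at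
  most \<open>k * r\<close>, because \<omega> is nonnegative. The two fractions
  \<open>a / (a + b)\<close> and \<open>b / (a + b)\<close> add up to 1.\<close>

lemma young_conjugate_superadditive:
  assumes w: "nonquasianalytic_weight \<omega>" and ab: "0 \<le> a" "0 \<le> b"
    and le: "young_conjugate \<omega> (a + b) \<le> ereal r"
  obtains p q where "young_conjugate \<omega> a = ereal p" "young_conjugate \<omega> b = ereal q" "p + q \<le> r"
proof -
  \<comment> \<open>If \<open>a + b = 0\<close>, both arguments vanish and any fraction in the unit
    interval would do.\<close>
  define l where "l = (if a + b = 0 then 0 else a / (a + b))"
  have l: "0 \<le> l" "l \<le> 1" "a = l * (a + b)"
    using ab by (auto simp: l_def divide_le_eq_1)
  then have l': "b = (1 - l) * (a + b)" by (simp add: algebra_simps)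
  have *: "young_conjugate \<omega> c \<le> ereal (k * r)" if k: "0 \<le> k" "k \<le> 1" "c = k * (a + b)" for c k
    unfolding young_conjugate_le_iff
  proof (intro allI impI)
    fix t :: real assume t: "0 \<le> t"
    have "(a + b) * t - \<omega> (exp t) \<le> r" using le t by (simp add: young_conjugate_le_iff)
    then have "k * ((a + b) * t - \<omega> (exp t)) \<le> k * r" using k(1) by (rule mult_left_mono)
    moreover have "k * \<omega> (exp t) \<le> \<omega> (exp t)" using k weight_nonneg[OF w] by (simp add: mult_left_le_one_le)
    ultimately show "c * t - \<omega> (exp t) \<le> k * r" unfolding k(3) by (simp add: algebra_simps)
  qed
  have A: "young_conjugate \<omega> a \<le> ereal (l * r)" by (rule *[OF l(1,2,3)])
  have B: "young_conjugate \<omega> b \<le> ereal ((1 - l) * r)" using l l' by (intro *) auto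
  obtain p where p: "young_conjugate \<omega> a = ereal p" "p \<le> l * r"
    using A young_conjugate_nonneg[OF w, of a] by (cases "young_conjugate \<omega> a") auto
  obtain q where q: "young_conjugate \<omega> b = ereal q" "q \<le> (1 - l) * r"
    using B young_conjugate_nonneg[OF w, of b] by (cases "young_conjugate \<omega> b") auto
  show thesis using that[OF p(1) q(1)] p(2) q(2) by (simp add: algebra_simps)
qed

text \<open>Evaluating the supremum for \<open>y\<close> at \<open>t + ln 2\<close> and using doubling gains the
  summand \<open>y ln 2\<close>, which absorbs the \<open>2 ^ \<bar>\<alpha>\<bar>\<close> terms of the Leibniz formula.\<close>

lemma young_conjugate_doubling:
  assumes "nonquasianalytic_weight \<omega>"
  obtains L :: nat where "L \<ge> 1"
    "\<And>y c. young_conjugate \<omega> y \<le> ereal c \<Longrightarrow>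
      young_conjugate \<omega> (y / L) \<le> ereal ((c + L - y * ln 2) / L)"
proof -
  obtain K :: real where K: "K \<ge> 1" "\<And>t. t \<ge> 0 \<Longrightarrow> \<omega> (2 * t) \<le> K * (1 + \<omega> t)"
    using assms unfolding nonquasianalytic_weight_def by blast
  \<comment> \<open>The doubling constant is rounded up to a natural number because
    \<open>m * L\<close> has to be the index of a level.\<close>
  define L where "L = nat \<lceil>K\<rceil>"
  have L: "L \<ge> 1" "K \<le> L" using K(1) unfolding L_def by linarith+
  have "young_conjugate \<omega> (y / L) \<le> ereal ((c + L - y * ln 2) / L)"
    if le: "young_conjugate \<omega> y \<le> ereal c" for y c
    unfolding young_conjugate_le_iff
  proof (intro allI impI)
    fix t :: real assume t: "0 \<le> t"
    have "y * (t + ln 2) - \<omega> (exp (t + ln 2)) \<le> c"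
      using le t unfolding young_conjugate_le_iff by auto
    moreover have "\<omega> (exp (t + ln 2)) \<le> K * (1 + \<omega> (exp t))"
      using K(2)[of "exp t"] by (simp add: exp_add mult.commute)
    moreover have "K * (1 + \<omega> (exp t)) \<le> L * (1 + \<omega> (exp t))"
      using L(2) weight_nonneg[OF assms, of "exp t"] by (intro mult_right_mono) auto
    ultimately have "y * t - L * \<omega> (exp t) \<le> c + L - y * ln 2" by (simp add: algebra_simps)
    then have "(y * t - L * \<omega> (exp t)) / L \<le> (c + L - y * ln 2) / L"
      by (rule divide_right_mono) simp
    then show "y / L * t - \<omega> (exp t) \<le> (c + L - y * ln 2) / L"
      using L(1) by (simp add: diff_divide_distrib)
  qed
  then show thesis using that[OF L(1)] by blast
qed

text \<open>The exponential factor of \<open>OMnorm\<close> as a real number, with \<open>k\<close>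
  the order of the derivative. An infinite conjugate gives 0, in accordance with the convention
  exp(-\<infinity>) = 0.\<close>

definition OMweight :: "(real \<Rightarrow> real) \<Rightarrow> nat \<Rightarrow> nat \<Rightarrow> nat \<Rightarrow> real^'N::finite \<Rightarrow> real" where
  "OMweight \<omega> m n k x = (if young_conjugate \<omega> (real k / real m) = \<infinity> then 0 else
     exp (- (real n * \<omega> (norm x)) - real m * real_of_ereal (young_conjugate \<omega> (real k / real m))))"

lemma OMweight_nonneg: "0 \<le> OMweight \<omega> m n k x"
  by (simp add: OMweight_def)

lemma ereal_OMweight:
  assumes "nonquasianalytic_weight \<omega>" "1 \<le> m"
  shows "exp_ereal (- ereal (real n * \<omega> (norm x)) - ereal (real m) * young_conjugate \<omega> (real k / real m)) =
    ereal (OMweight \<omega> m n k x)"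
  using young_conjugate_nonneg[OF assms(1), of "real k / real m"] assms(2)
  by (cases "young_conjugate \<omega> (real k / real m)") (auto simp: OMweight_def exp_ereal_def)

lemma OMweight_antimono:
  assumes "nonquasianalytic_weight \<omega>" "n \<le> n'"
  shows "OMweight \<omega> m n' k x \<le> OMweight \<omega> m n k x"
  using weight_nonneg[OF assms(1), of "norm x"] assms(2)
  by (auto simp: OMweight_def mult_right_mono)

text \<open>For \<open>y = (i + j) / m\<close>, doubling bounds the conjugate at
  \<open>y / L\<close>, and superadditivity distributes that bound over \<open>i / (m * L)\<close>
  and \<open>j / (m * L)\<close>. If the conjugate at \<open>y\<close> is infinite, the left side is
  0.\<close>

lemma OMweight_submultiplicative:
  assumes w: "nonquasianalytic_weight \<omega>"
  obtains L :: nat where "1 \<le> L"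
    "\<And>m n n' i j x. 1 \<le> m \<Longrightarrow> 2 ^ (i + j) * OMweight \<omega> m (n + n') (i + j) (x :: real^'N::finite) \<le>
      exp (real m * real L) * (OMweight \<omega> (m * L) n i x * OMweight \<omega> (m * L) n' j x)"
proof -
  obtain L :: nat where L: "L \<ge> 1"
    "\<And>y c. young_conjugate \<omega> y \<le> ereal c \<Longrightarrow>
      young_conjugate \<omega> (y / L) \<le> ereal ((c + L - y * ln 2) / L)"
    using young_conjugate_doubling[OF w] by blast
  have "2 ^ (i + j) * OMweight \<omega> m (n + n') (i + j) x \<le>
      exp (real m * real L) * (OMweight \<omega> (m * L) n i x * OMweight \<omega> (m * L) n' j x)"
    if m: "1 \<le> m" for m n n' i j and x :: "real^'N"
  proof (cases "young_conjugate \<omega> (real (i + j) / m)")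
    case (real c)
    define y where "y = real (i + j) / m"
    have yc: "young_conjugate \<omega> y \<le> ereal c" using real by (simp add: y_def)
    have "y / L = real i / real (m * L) + real j / real (m * L)"
      by (simp add: y_def add_divide_distrib)
    then have "young_conjugate \<omega> (real i / real (m * L) + real j / real (m * L)) \<le>
        ereal ((c + L - y * ln 2) / L)"
      using L(2)[OF yc] by simp
    then obtain p q where pq: "young_conjugate \<omega> (real i / real (m * L)) = ereal p"
      "young_conjugate \<omega> (real j / real (m * L)) = ereal q" "p + q \<le> (c + L - y * ln 2) / L"
      by (rule young_conjugate_superadditive[OF w, rotated 2]) auto
    \<comment> \<open>Clearing denominators turns the gain \<open>y * ln 2\<close> into
      \<open>(i + j) * ln 2\<close>, which is the logarithm of \<open>2 ^ (i + j)\<close>.\<close>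
    have "real m * (L * (p + q)) \<le> real m * (c + L - y * ln 2)"
      using pq(3) L(1) by (intro mult_left_mono) (auto simp: field_simps)
    also have "\<dots> = real m * c + real m * L - (real m * y) * ln 2"
      by (simp add: algebra_simps)
    also have "real m * y = real (i + j)"
      using m by (simp add: y_def)
    finally have main: "real (i + j) * ln 2 - real m * c \<le> real m * L - real m * L * (p + q)"
      by (simp add: algebra_simps)
    have pow: "(2::real) ^ (i + j) = exp (real (i + j) * ln 2)"
      by (subst exp_of_nat_mult) simp
    have "2 ^ (i + j) * OMweight \<omega> m (n + n') (i + j) x =
        exp (real (i + j) * ln 2 + (- (real (n + n') * \<omega> (norm x)) - real m * c))"
      unfolding pow using real by (simp add: OMweight_def exp_add)
    also have "\<dots> \<le> exp (real m * real L + ((- (real n * \<omega> (norm x)) - real (m * L) * p) +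
        (- (real n' * \<omega> (norm x)) - real (m * L) * q)))"
      using main by (simp add: algebra_simps)
    also have "\<dots> = exp (real m * real L) * (OMweight \<omega> (m * L) n i x * OMweight \<omega> (m * L) n' j x)"
      using pq(1,2) unfolding exp_add by (simp add: OMweight_def)
    finally show ?thesis .
  next
    case PInf
    then show ?thesis by (simp add: OMweight_def)
  next
    case MInf
    then show ?thesis using young_conjugate_nonneg[OF w, of "real (i + j) / m"] by simp
  qed
  then show thesis using that[OF L(1)] by blast
qed

section \<open>The norms of the steps and their behaviour under multiplication\<close>

lemma OMnorm_eq:
  assumes "nonquasianalytic_weight \<omega>" "1 \<le> m"
  shows "OMnorm \<omega> m n f =
    (SUP \<alpha>. SUP x. ereal (cmod (mderiv \<alpha> f x) * OMweight \<omega> m n (\<Sum>i\<in>UNIV. \<alpha> i) x))"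
  unfolding OMnorm_def ereal_OMweight[OF assms] by simp

lemma OMnorm_le_iff:
  assumes "nonquasianalytic_weight \<omega>" "1 \<le> m"
  shows "OMnorm \<omega> m n f \<le> ereal c \<longleftrightarrow>
    (\<forall>\<alpha> x. cmod (mderiv \<alpha> f x) * OMweight \<omega> m n (\<Sum>i\<in>UNIV. \<alpha> i) x \<le> c)"
  unfolding OMnorm_eq[OF assms] by (simp add: SUP_le_iff)

lemma OMnorm_mono:
  assumes "nonquasianalytic_weight \<omega>" "1 \<le> m" "n \<le> n'"
  shows "OMnorm \<omega> m n' f \<le> OMnorm \<omega> m n f"
  unfolding OMnorm_eq[OF assms(1,2)]
  by (intro SUP_mono' ereal_less_eq(3)[THEN iffD2] mult_left_mono OMweight_antimono assms) simp

text \<open>All terms are nonnegative, so the factor can be taken out of both suprema in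
  \<open>ereal\<close>, even if they are infinite.\<close>

lemma OMnorm_scale:
  assumes "nonquasianalytic_weight \<omega>" "1 \<le> m" "smooth f"
  shows "OMnorm \<omega> m n (\<lambda>x. c * f x) = ereal (cmod c) * OMnorm \<omega> m n f"
proof -
  let ?a = "\<lambda>\<alpha> x. cmod (mderiv \<alpha> f x) * OMweight \<omega> m n (\<Sum>i\<in>UNIV. \<alpha> i) x"
  have nonneg: "0 \<le> ?a \<alpha> x" for \<alpha> x by (simp add: OMweight_nonneg)
  have "OMnorm \<omega> m n (\<lambda>x. c * f x) = (SUP \<alpha>. SUP x. ereal (cmod c) * ereal (?a \<alpha> x))"
    unfolding OMnorm_eq[OF assms(1,2)] mderiv_eq_foldr foldr_partial_scale[OF assms(3)]
    by (simp add: norm_mult mult.assoc)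
  also have "\<dots> = (SUP \<alpha>. ereal (cmod c) * (SUP x. ereal (?a \<alpha> x)))"
    by (intro SUP_cong refl SUP_ereal_mult_left) (auto simp: nonneg)
  also have "\<dots> = ereal (cmod c) * (SUP \<alpha>. SUP x. ereal (?a \<alpha> x))"
    by (intro SUP_ereal_mult_left) (auto simp: nonneg intro: SUP_upper2)
  finally show ?thesis unfolding OMnorm_eq[OF assms(1,2)] .
qed

text \<open>The number of Leibniz terms is absorbed by the factor \<open>2 ^ (i + j)\<close> in
  \<open>OMweight_submultiplicative\<close>, which leaves a constant independent of the order of
  differentiation.\<close>

lemma OMnorm_mult:
  assumes w: "nonquasianalytic_weight \<omega>"
  obtains L :: nat where "1 \<le> L"
    "\<And>m n n' f g a b. 1 \<le> m \<Longrightarrow> smooth f \<Longrightarrow> smooth (g :: real^'N::finite \<Rightarrow> complex) \<Longrightarrow> 0 \<le> a \<Longrightarrow> 0 \<le> b \<Longrightarrow>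
      OMnorm \<omega> (m * L) n f \<le> ereal a \<Longrightarrow> OMnorm \<omega> (m * L) n' g \<le> ereal b \<Longrightarrow>
      OMnorm \<omega> m (n + n') (\<lambda>x. f x * g x) \<le> ereal (exp (real m * real L) * (a * b))"
proof -
  obtain L :: nat where L: "1 \<le> L"
    "\<And>m n n' i j x. 1 \<le> m \<Longrightarrow> 2 ^ (i + j) * OMweight \<omega> m (n + n') (i + j) (x :: real^'N) \<le>
      exp (real m * real L) * (OMweight \<omega> (m * L) n i x * OMweight \<omega> (m * L) n' j x)"
    using OMweight_submultiplicative[OF w] by blast
  have "OMnorm \<omega> m (n + n') (\<lambda>x. f x * g x) \<le> ereal (exp (real m * real L) * (a * b))"
    if m: "1 \<le> m" and smooth: "smooth f" "smooth g" and ab: "0 \<le> a" "0 \<le> b"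
      and f: "OMnorm \<omega> (m * L) n f \<le> ereal a" and g: "OMnorm \<omega> (m * L) n' g \<le> ereal b"
    for m n n' f a b and g :: "real^'N \<Rightarrow> complex"
    unfolding OMnorm_le_iff[OF w m]
  proof (intro allI)
    fix \<alpha> :: "'N \<Rightarrow> nat" and x :: "real^'N"
    let ?k = "\<Sum>i\<in>UNIV. \<alpha> i"
    let ?C = "exp (real m * real L) * (a * b)"
    have mL: "1 \<le> m * L" using m L(1) by simp
    \<comment> \<open>A vanishing weight makes the claim trivial; otherwise one may divide by
      \<open>W\<close>.\<close>
    define W where "W = OMweight \<omega> m (n + n') ?k x"
    show "cmod (mderiv \<alpha> (\<lambda>x. f x * g x) x) * OMweight \<omega> m (n + n') ?k x \<le> ?C"
    proof (cases "W = 0")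
      case True
      then show ?thesis using ab by (simp add: W_def)
    next
      case False
      then have W: "0 < W" using OMweight_nonneg[of \<omega> m "n + n'" ?k x] by (simp add: W_def)
      \<comment> \<open>The denominator contains \<open>2 ^ ?k\<close> so that it cancels against
        the number of terms in \<open>mderiv_mult_bound\<close>.\<close>
      have "cmod (mderiv \<beta> f x) * cmod (mderiv \<gamma> g x) \<le> ?C / (2 ^ ?k * W)"
        if deg: "(\<Sum>i\<in>UNIV. \<beta> i) + (\<Sum>i\<in>UNIV. \<gamma> i) = ?k" for \<beta> \<gamma>
      proof -
        let ?u = "OMweight \<omega> (m * L) n (\<Sum>i\<in>UNIV. \<beta> i) x"
        let ?v = "OMweight \<omega> (m * L) n' (\<Sum>i\<in>UNIV. \<gamma> i) x"
        let ?F = "cmod (mderiv \<beta> f x)" and ?G = "cmod (mderiv \<gamma> g x)"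
        have "?F * ?G * (2 ^ ?k * W) \<le> ?F * ?G * (exp (real m * real L) * (?u * ?v))"
          using L(2)[OF m, of "\<Sum>i\<in>UNIV. \<beta> i" "\<Sum>i\<in>UNIV. \<gamma> i" n n' x] deg
          by (intro mult_left_mono) (auto simp: W_def)
        also have "\<dots> = exp (real m * real L) * ((?F * ?u) * (?G * ?v))" by simp
        also have "\<dots> \<le> ?C"
          using f g ab unfolding OMnorm_le_iff[OF w mL]
          by (intro mult_left_mono mult_mono) (auto simp: OMweight_nonneg)
        finally show ?thesis using W by (simp add: pos_le_divide_eq)
      qed
      from mderiv_mult_bound[OF smooth this]
      have "cmod (mderiv \<alpha> (\<lambda>x. f x * g x) x) \<le> 2 ^ ?k * (?C / (2 ^ ?k * W))" .
      also have "\<dots> = ?C / W" by simp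
      finally show ?thesis using W by (simp add: pos_le_divide_eq flip: W_def)
    qed
  qed
  then show thesis using that[OF L(1)] by blast
qed

section \<open>Passage to the inductive and projective limits\<close>

lemma normed_steps_OM:
  assumes w: "nonquasianalytic_weight \<omega>" and m: "1 \<le> m"
  shows "normed_steps (OMstep \<omega> m :: nat \<Rightarrow> (real^'N::finite \<Rightarrow> complex) set) (OMnorm \<omega> m)"
proof
  have bound: "\<exists>c. OMnorm \<omega> m n f \<le> ereal c" if "OMnorm \<omega> m n f < \<infinity>" for n and f :: "real^'N \<Rightarrow> complex"
    using that by (cases "OMnorm \<omega> m n f") auto
  have finite: "OMnorm \<omega> m n f < \<infinity>" if "OMnorm \<omega> m n f \<le> ereal c" for n c and f :: "real^'N \<Rightarrow> complex"
    using that by (rule le_less_trans) simp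
  fix n :: nat
  show "fun_subspace (OMstep \<omega> m n :: (real^'N \<Rightarrow> complex) set)"
    unfolding fun_subspace_def
  proof (intro conjI ballI allI)
    have "OMnorm \<omega> m n (\<lambda>x::real^'N. 0) \<le> ereal 0"
      unfolding OMnorm_le_iff[OF w m] by (simp add: mderiv_eq_foldr smooth_zero)
    from finite[OF this] show "(\<lambda>x. 0) \<in> (OMstep \<omega> m n :: (real^'N \<Rightarrow> complex) set)"
      by (simp add: OMstep_def smooth_zero)
  next
    fix f g :: "real^'N \<Rightarrow> complex" assume fg: "f \<in> OMstep \<omega> m n" "g \<in> OMstep \<omega> m n"
    then have "OMnorm \<omega> m n f < \<infinity>" "OMnorm \<omega> m n g < \<infinity>" by (auto simp: OMstep_def)
    then obtain a b where "OMnorm \<omega> m n f \<le> ereal a" "OMnorm \<omega> m n g \<le> ereal b"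
      using bound by blast
    then have ab: "cmod (mderiv \<alpha> f x) * OMweight \<omega> m n (\<Sum>i\<in>UNIV. \<alpha> i) x \<le> a"
        "cmod (mderiv \<alpha> g x) * OMweight \<omega> m n (\<Sum>i\<in>UNIV. \<alpha> i) x \<le> b" for \<alpha> x
      unfolding OMnorm_le_iff[OF w m] by auto
    have "OMnorm \<omega> m n (\<lambda>x. f x + g x) \<le> ereal (a + b)"
      unfolding OMnorm_le_iff[OF w m]
    proof (intro allI)
      fix \<alpha> :: "'N \<Rightarrow> nat" and x :: "real^'N"
      let ?W = "OMweight \<omega> m n (\<Sum>i\<in>UNIV. \<alpha> i) x"
      have "mderiv \<alpha> (\<lambda>x. f x + g x) x = mderiv \<alpha> f x + mderiv \<alpha> g x"
        using fg by (simp add: mderiv_eq_foldr foldr_partial_add OMstep_def)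
      then have "cmod (mderiv \<alpha> (\<lambda>x. f x + g x) x) * ?W \<le> (cmod (mderiv \<alpha> f x) + cmod (mderiv \<alpha> g x)) * ?W"
        by (intro mult_right_mono OMweight_nonneg) (simp add: norm_triangle_ineq)
      also have "\<dots> \<le> a + b" using ab[of \<alpha> x] by (simp add: distrib_right)
      finally show "cmod (mderiv \<alpha> (\<lambda>x. f x + g x) x) * ?W \<le> a + b" .
    qed
    from finite[OF this] show "(\<lambda>x. f x + g x) \<in> OMstep \<omega> m n"
      using fg by (simp add: OMstep_def smooth_add)
  next
    fix c :: complex and f :: "real^'N \<Rightarrow> complex" assume "f \<in> OMstep \<omega> m n"
    then have f: "smooth f" "OMnorm \<omega> m n f < \<infinity>" by (auto simp: OMstep_def)
    obtain a where "OMnorm \<omega> m n f \<le> ereal a" using bound[OF f(2)] by blast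
    then have "OMnorm \<omega> m n (\<lambda>x. c * f x) \<le> ereal (cmod c) * ereal a"
      unfolding OMnorm_scale[OF w m f(1)] by (intro ereal_mult_left_mono) auto
    then have "OMnorm \<omega> m n (\<lambda>x. c * f x) < \<infinity>" by (auto intro: finite)
    then show "(\<lambda>x. c * f x) \<in> OMstep \<omega> m n" using f(1) by (simp add: OMstep_def smooth_scale)
  qed
  show "OMstep \<omega> m n \<subseteq> (OMstep \<omega> m k :: (real^'N \<Rightarrow> complex) set)" if "n \<le> k" for k
    using le_less_trans[OF OMnorm_mono[OF w m that]] by (auto simp: OMstep_def simp del: ereal_infty_less)
  show "OMnorm \<omega> m n f < \<infinity>" if "f \<in> OMstep \<omega> m n" for f :: "real^'N \<Rightarrow> complex"
    using that by (simp add: OMstep_def)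
  show "OMnorm \<omega> m n (\<lambda>x. c * f x) = ereal (cmod c) * OMnorm \<omega> m n f"
    if "f \<in> OMstep \<omega> m n" for c and f :: "real^'N \<Rightarrow> complex"
    using that by (intro OMnorm_scale[OF w m]) (simp add: OMstep_def)
qed

text \<open>The abstract result applies with the constant \<open>exp (m * L)\<close>. One
  \<open>L\<close> serves all levels \<open>m\<close>.\<close>

lemma continuous_map_mult_OMind:
  assumes w: "nonquasianalytic_weight \<omega>"
  obtains L :: nat where "1 \<le> L"
    "\<And>m. 1 \<le> m \<Longrightarrow> continuous_map (prod_topology (OMind_topology \<omega> (m * L)) (OMind_topology \<omega> (m * L)))
      (OMind_topology \<omega> m) (\<lambda>(f, g) (x :: real^'N::finite). f x * g x)"
proof -
  obtain L :: nat where L: "1 \<le> L"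
    "\<And>m n n' f g a b. 1 \<le> m \<Longrightarrow> smooth f \<Longrightarrow> smooth (g :: real^'N \<Rightarrow> complex) \<Longrightarrow> 0 \<le> a \<Longrightarrow> 0 \<le> b \<Longrightarrow>
      OMnorm \<omega> (m * L) n f \<le> ereal a \<Longrightarrow> OMnorm \<omega> (m * L) n' g \<le> ereal b \<Longrightarrow>
      OMnorm \<omega> m (n + n') (\<lambda>x. f x * g x) \<le> ereal (exp (real m * real L) * (a * b))"
    using OMnorm_mult[OF w] by blast
  have "continuous_map (prod_topology (OMind_topology \<omega> (m * L)) (OMind_topology \<omega> (m * L)))
      (OMind_topology \<omega> m) (\<lambda>(f, g) (x :: real^'N). f x * g x)" if m: "1 \<le> m" for m
    unfolding OMind_topology_def OMstep_topology_def
  proof (rule continuous_map_mult_inductive_limit)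
    show "normed_steps (OMstep \<omega> (m * L) :: nat \<Rightarrow> (real^'N \<Rightarrow> complex) set) (OMnorm \<omega> (m * L))"
      "normed_steps (OMstep \<omega> m :: nat \<Rightarrow> (real^'N \<Rightarrow> complex) set) (OMnorm \<omega> m)"
      using m L(1) by (auto intro: normed_steps_OM[OF w])
    show "1 \<le> exp (real m * real L)" by simp
    fix n k a b and f g :: "real^'N \<Rightarrow> complex"
    assume *: "f \<in> OMstep \<omega> (m * L) n" "g \<in> OMstep \<omega> (m * L) k" "0 < a" "0 < b"
      "OMnorm \<omega> (m * L) n f < ereal a" "OMnorm \<omega> (m * L) k g < ereal b"
    then have "OMnorm \<omega> m (n + k) (\<lambda>x. f x * g x) \<le> ereal (exp (real m * real L) * (a * b))"
      by (intro L(2)[OF m]) (auto simp: OMstep_def)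
    moreover from this have "OMnorm \<omega> m (n + k) (\<lambda>x. f x * g x) < \<infinity>"
      by (rule le_less_trans) simp
    ultimately show "(\<lambda>x. f x * g x) \<in> OMstep \<omega> m (n + k) \<and>
        OMnorm \<omega> m (n + k) (\<lambda>x. f x * g x) \<le> ereal (exp (real m * real L) * (a * b))"
      using * by (simp add: OMstep_def smooth_mult)
  qed
  then show thesis using that[OF L(1)] by blast
qed

theorem theorem3p2:
  fixes \<omega> :: "real \<Rightarrow> real"
  assumes "nonquasianalytic_weight \<omega>"
  shows "(\<forall>f \<in> (OM \<omega> :: (real^'N \<Rightarrow> complex) set). \<forall>g \<in> OM \<omega>. (\<lambda>x. f x * g x) \<in> OM \<omega>) \<and>
    continuous_map
      (prod_topology (OM_topology \<omega>) (OM_topology \<omega>))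
      (OM_topology \<omega> :: (real^'N \<Rightarrow> complex) topology)
      (\<lambda>(f, g) x. f x * g x)"
proof -
  let ?P = "prod_topology (OM_topology \<omega>) (OM_topology \<omega>) ::
    ((real^'N \<Rightarrow> complex) \<times> (real^'N \<Rightarrow> complex)) topology"
  obtain L :: nat where L: "1 \<le> L"
    "\<And>m. 1 \<le> m \<Longrightarrow> continuous_map (prod_topology (OMind_topology \<omega> (m * L)) (OMind_topology \<omega> (m * L)))
      (OMind_topology \<omega> m) (\<lambda>(f, g) (x :: real^'N). f x * g x)"
    using continuous_map_mult_OMind[OF assms] by blast
  \<comment> \<open>For level \<open>m\<close> of the target, both factors are first included into
    level \<open>m * L\<close>, where multiplication into level \<open>m\<close> is
    continuous.\<close>
  have "continuous_map ?P (OMind_topology \<omega> m) (\<lambda>(f, g) x. f x * g x)" if "m \<in> {1..}" for m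
  proof -
    have m: "1 \<le> m" "m * L \<in> {1..}" using that L(1) by auto
    have incl: "continuous_map (OM_topology \<omega> :: (real^'N \<Rightarrow> complex) topology) (OMind_topology \<omega> (m * L)) (\<lambda>f. f)"
      unfolding OM_topology_def by (rule continuous_map_from_projective_limit[OF m(2)])
    have "continuous_map ?P (prod_topology (OMind_topology \<omega> (m * L)) (OMind_topology \<omega> (m * L))) (\<lambda>p. p)"
      using incl continuous_map_prod_top[where f = "\<lambda>f. f" and g = "\<lambda>f. f"]
      by (auto simp: case_prod_unfold)
    from continuous_map_compose[OF this L(2)[OF m(1)]] show ?thesis by (simp add: o_def)
  qed
  then have "continuous_map ?P (projective_limit_topology {1..} (OMind_topology \<omega>)) (\<lambda>(f, g) x. f x * g x)"
    by (intro continuous_map_into_projective_limit) auto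
  then have cont: "continuous_map ?P (OM_topology \<omega>) (\<lambda>(f, g) x. f x * g x)"
    by (simp only: OM_topology_def)
  \<comment> \<open>Closure under products is part of continuity: a continuous map sends the
    underlying set of its domain into that of its target.\<close>
  moreover have "(\<lambda>x. f x * g x) \<in> OM \<omega>" if "f \<in> OM \<omega>" "g \<in> OM \<omega>" for f g :: "real^'N \<Rightarrow> complex"
    using continuous_map_image_subset_topspace[OF cont] that
    by (force simp: topspace_OM_topology)
  ultimately show ?thesis by blast
qed

end
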